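(* Let $X$ and $Y$ be non-zero complex Banach spaces such that $Y$ is separable and reflexive. Assume $X$ satisfies one of the following: (1) $X=L_p[0,1]$, where $1<p<\infty$; or (2) $X$ is a reflexive Banach space with a subsymmetric Schauder basis. Let $\phi\colon \mathcal{B}(X)\to\mathcal{B}(Y)$ be a continuous, injective algebra homomorphism. If $\operatorname{Ran}(\phi)$ contains an operator with dense range, and $\phi$ maps rank one idempotents into rank one idempotents, then $\phi$ is an isomorphism of Banach algebras.
   Context: All Banach spaces are complex. $\mathcal{B}(X)$ is the Banach algebra of bounded linear operators on $X$ with the operator norm. $\operatorname{Ran}(\phi)$ is the range of $\phi$. An idempotent in an algebra is an element $p$ with $p^2=p$; a rank one idempotent in $\mathcal{B}(X)$ is an idempotent operator with one-dimensional range. Algebra homomorphisms are linear and multiplicative (not assumed unital). An isomorphism of Banach algebras is an algebra homomorphism which is also a homeomorphism (in particular bijective). A Schauder basis $(b_n)_{n\in\mathbb{N}}$ of $X$ is subsymmetric if it is unconditional and, for every strictly increasing $\sigma\colon\mathbb{N}\to\mathbb{N}$, the basic sequence $(b_{\sigma(n)})_{n\in\mathbb{N}}$ is equivalent to $(b_n)_{n\in\mathbb{N}}$. $L_p[0,1]$ is taken with respect to Lebesgue measure. *)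

theory Defs
  imports "HOL-Analysis.Analysis"
begin

section \<open>Complex Banach spaces\<close>

text \<open>
  A complex normed space is a real normed space (with the library's norm, metric and topology)
  together with a compatible complex scalar multiplication.
\<close>

class complex_normed_vector = real_normed_vector +
  fixes scaleC :: "complex \<Rightarrow> 'a \<Rightarrow> 'a"  (infixr \<open>*\<^sub>C\<close> 75)
  assumes scaleC_add_right: "a *\<^sub>C (x + y) = a *\<^sub>C x + a *\<^sub>C y"
    and scaleC_add_left: "(a + b) *\<^sub>C x = a *\<^sub>C x + b *\<^sub>C x"
    and scaleC_scaleC: "a *\<^sub>C b *\<^sub>C x = (a * b) *\<^sub>C x"
    and scaleC_one: "1 *\<^sub>C x = x"
    and scaleR_scaleC: "r *\<^sub>R x = complex_of_real r *\<^sub>C x"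
    and norm_scaleC: "norm (a *\<^sub>C x) = cmod a * norm x"

class complex_banach = complex_normed_vector + complete_space

subclass (in complex_banach) banach ..

global_interpretation complex_vector:
  vector_space "scaleC :: complex \<Rightarrow> 'a \<Rightarrow> 'a::complex_normed_vector"
  by unfold_locales (simp_all add: scaleC_add_right scaleC_add_left scaleC_scaleC scaleC_one)

abbreviation clinear :: "('a::complex_normed_vector \<Rightarrow> 'b::complex_normed_vector) \<Rightarrow> bool"
  where "clinear \<equiv> Vector_Spaces.linear (*\<^sub>C) (*\<^sub>C)"

lemma clinear_iff:
  "clinear f \<longleftrightarrow> (\<forall>x y. f (x + y) = f x + f y) \<and> (\<forall>c x. f (c *\<^sub>C x) = c *\<^sub>C f x)"
  by (auto simp: Vector_Spaces.linear_def module_hom_def module_hom_axioms_def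
      complex_vector.vector_space_axioms complex_vector.module_axioms)

lemma bounded_linear_scaleC: "bounded_linear (\<lambda>x::'a::complex_normed_vector. c *\<^sub>C x)"
proof (rule bounded_linear_intro[where K = "cmod c"])
  show "c *\<^sub>C (r *\<^sub>R x) = r *\<^sub>R (c *\<^sub>C x)" for r and x :: 'a
    by (simp add: scaleR_scaleC scaleC_scaleC mult.commute)
qed (simp_all add: scaleC_add_right norm_scaleC mult.commute)

instantiation complex :: complex_banach
begin

definition scaleC_complex :: "complex \<Rightarrow> complex \<Rightarrow> complex"
  where "scaleC_complex = (*)"

instance
  by standard (simp_all add: scaleC_complex_def algebra_simps norm_mult scaleR_conv_of_real)

end


section \<open>Bounded complex-linear operators\<close>

typedef (overloaded) ('a, 'b) cblinfun (\<open>(_ \<Rightarrow>\<^sub>C\<^sub>L /_)\<close> [22, 21] 21)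
  = "{f :: 'a::complex_normed_vector \<Rightarrow>\<^sub>L 'b::complex_normed_vector. clinear (blinfun_apply f)}"
  morphisms blinfun_of_cblinfun Abs_cblinfun
proof (rule exI[of _ 0])
  show "0 \<in> {f :: 'a \<Rightarrow>\<^sub>L 'b. clinear (blinfun_apply f)}"
    by (simp add: clinear_iff)
qed

setup_lifting type_definition_cblinfun

lift_definition cblinfun_apply ::
  "('a::complex_normed_vector \<Rightarrow>\<^sub>C\<^sub>L 'b::complex_normed_vector) \<Rightarrow> 'a \<Rightarrow> 'b"
  is blinfun_apply .

lift_definition cblinfun_compose ::
  "('b::complex_normed_vector \<Rightarrow>\<^sub>C\<^sub>L 'c::complex_normed_vector) \<Rightarrow>
   ('a::complex_normed_vector \<Rightarrow>\<^sub>C\<^sub>L 'b) \<Rightarrow> ('a \<Rightarrow>\<^sub>C\<^sub>L 'c)"  (infixl \<open>o\<^sub>C\<^sub>L\<close> 67)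
  is blinfun_compose
  by (simp add: clinear_iff)

lemma scaleC_apply_aux:
  "blinfun_apply (Blinfun (\<lambda>x. c *\<^sub>C blinfun_apply (f :: 'a::complex_normed_vector \<Rightarrow>\<^sub>L 'b::complex_normed_vector) x)) = (\<lambda>x. c *\<^sub>C blinfun_apply f x)"
  by (intro bounded_linear_Blinfun_apply bounded_linear_compose[OF bounded_linear_scaleC]
      blinfun.bounded_linear_right)

text \<open>The norm is the operator norm, inherited from the library type of bounded real-linear maps.\<close>

instantiation cblinfun :: (complex_normed_vector, complex_normed_vector) complex_normed_vector
begin

lift_definition zero_cblinfun :: "'a \<Rightarrow>\<^sub>C\<^sub>L 'b" is 0
  by (simp add: clinear_iff)

lift_definition plus_cblinfun :: "('a \<Rightarrow>\<^sub>C\<^sub>L 'b) \<Rightarrow> ('a \<Rightarrow>\<^sub>C\<^sub>L 'b) \<Rightarrow> ('a \<Rightarrow>\<^sub>C\<^sub>L 'b)" is "(+)"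
  by (simp add: clinear_iff blinfun.bilinear_simps scaleC_add_right)

lift_definition minus_cblinfun :: "('a \<Rightarrow>\<^sub>C\<^sub>L 'b) \<Rightarrow> ('a \<Rightarrow>\<^sub>C\<^sub>L 'b) \<Rightarrow> ('a \<Rightarrow>\<^sub>C\<^sub>L 'b)" is "(-)"
  by (simp add: clinear_iff blinfun.bilinear_simps complex_vector.scale_right_diff_distrib)

lift_definition uminus_cblinfun :: "('a \<Rightarrow>\<^sub>C\<^sub>L 'b) \<Rightarrow> ('a \<Rightarrow>\<^sub>C\<^sub>L 'b)" is uminus
  by (simp add: clinear_iff blinfun.bilinear_simps)

lift_definition scaleR_cblinfun :: "real \<Rightarrow> ('a \<Rightarrow>\<^sub>C\<^sub>L 'b) \<Rightarrow> ('a \<Rightarrow>\<^sub>C\<^sub>L 'b)" is "(*\<^sub>R)"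
  by (simp add: clinear_iff blinfun.bilinear_simps scaleR_add_right scaleR_scaleC scaleC_scaleC
      mult.commute)

lift_definition scaleC_cblinfun :: "complex \<Rightarrow> ('a \<Rightarrow>\<^sub>C\<^sub>L 'b) \<Rightarrow> ('a \<Rightarrow>\<^sub>C\<^sub>L 'b)"
  is "\<lambda>c f. Blinfun (\<lambda>x. c *\<^sub>C blinfun_apply f x)"
  by (simp add: clinear_iff scaleC_apply_aux blinfun.bilinear_simps scaleC_add_right scaleC_scaleC
      mult.commute)

lift_definition norm_cblinfun :: "('a \<Rightarrow>\<^sub>C\<^sub>L 'b) \<Rightarrow> real" is norm .

definition dist_cblinfun :: "('a \<Rightarrow>\<^sub>C\<^sub>L 'b) \<Rightarrow> ('a \<Rightarrow>\<^sub>C\<^sub>L 'b) \<Rightarrow> real"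
  where "dist_cblinfun f g = norm (f - g)"

definition sgn_cblinfun :: "('a \<Rightarrow>\<^sub>C\<^sub>L 'b) \<Rightarrow> ('a \<Rightarrow>\<^sub>C\<^sub>L 'b)"
  where "sgn_cblinfun f = scaleR (inverse (norm f)) f"

definition [code del]:
  "(uniformity :: (('a \<Rightarrow>\<^sub>C\<^sub>L 'b) \<times> ('a \<Rightarrow>\<^sub>C\<^sub>L 'b)) filter)
     = (INF e\<in>{0 <..}. principal {(x, y). dist x y < e})"

definition open_cblinfun :: "('a \<Rightarrow>\<^sub>C\<^sub>L 'b) set \<Rightarrow> bool"
  where [code del]: "open_cblinfun S = (\<forall>x\<in>S. \<forall>\<^sub>F (x', y) in uniformity. x' = x \<longrightarrow> y \<in> S)"

lemma cblinfun_eqI: "(\<And>x. cblinfun_apply f x = cblinfun_apply g x) \<Longrightarrow> f = g"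
  for f g :: "'a \<Rightarrow>\<^sub>C\<^sub>L 'b"
  by transfer (rule blinfun_eqI)

lemma cblinfun_apply_add: "cblinfun_apply (f + g) x = cblinfun_apply f x + cblinfun_apply g x"
  for f g :: "'a \<Rightarrow>\<^sub>C\<^sub>L 'b"
  by transfer (simp add: blinfun.bilinear_simps)

lemma cblinfun_apply_scaleR: "cblinfun_apply (scaleR r f) x = r *\<^sub>R cblinfun_apply f x"
  for f :: "'a \<Rightarrow>\<^sub>C\<^sub>L 'b"
  by transfer (simp add: blinfun.bilinear_simps)

lemma cblinfun_apply_scaleC: "cblinfun_apply (scaleC c f) x = c *\<^sub>C cblinfun_apply f x"
  for f :: "'a \<Rightarrow>\<^sub>C\<^sub>L 'b"
  by transfer (simp add: scaleC_apply_aux)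

instance
proof
  fix f g h :: "'a \<Rightarrow>\<^sub>C\<^sub>L 'b" and a b :: complex and r s :: real
  show "f + g + h = f + (g + h)" by transfer simp
  show "f + g = g + f" by transfer simp
  show "0 + f = f" by transfer simp
  show "- f + f = 0" by transfer simp
  show "f - g = f + - g" by transfer simp
  show "r *\<^sub>R (f + g) = r *\<^sub>R f + r *\<^sub>R g" by transfer (rule scaleR_add_right)
  show "(r + s) *\<^sub>R f = r *\<^sub>R f + s *\<^sub>R f" by transfer (rule scaleR_add_left)
  show "r *\<^sub>R s *\<^sub>R f = (r * s) *\<^sub>R f" by transfer simp
  show "1 *\<^sub>R f = f" by transfer simp
  show "dist f g = norm (f - g)" by (rule dist_cblinfun_def)
  show "sgn f = scaleR (inverse (norm f)) f" by (rule sgn_cblinfun_def)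
  show "(uniformity :: (('a \<Rightarrow>\<^sub>C\<^sub>L 'b) \<times> ('a \<Rightarrow>\<^sub>C\<^sub>L 'b)) filter)
     = (INF e\<in>{0 <..}. principal {(x, y). dist x y < e})"
    by (rule uniformity_cblinfun_def)
  show "open U = (\<forall>x\<in>U. \<forall>\<^sub>F (x', y) in uniformity. x' = x \<longrightarrow> y \<in> U)" for U :: "('a \<Rightarrow>\<^sub>C\<^sub>L 'b) set"
    by (rule open_cblinfun_def)
  show "norm f = 0 \<longleftrightarrow> f = 0" by transfer simp
  show "norm (f + g) \<le> norm f + norm g" by transfer (rule norm_triangle_ineq)
  show "norm (r *\<^sub>R f) = \<bar>r\<bar> * norm f" by transfer simp
  show "a *\<^sub>C (f + g) = a *\<^sub>C f + a *\<^sub>C g"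
    and "(a + b) *\<^sub>C f = a *\<^sub>C f + b *\<^sub>C f"
    and "a *\<^sub>C b *\<^sub>C f = (a * b) *\<^sub>C f"
    and "1 *\<^sub>C f = f"
    and "r *\<^sub>R f = complex_of_real r *\<^sub>C f"
    by (rule cblinfun_eqI, simp add: cblinfun_apply_add cblinfun_apply_scaleR cblinfun_apply_scaleC
        scaleC_add_right scaleC_add_left scaleC_scaleC scaleC_one scaleR_scaleC)+
  show "norm (a *\<^sub>C f) = cmod a * norm f"
  proof transfer
    fix a :: complex and f :: "'a \<Rightarrow>\<^sub>L 'b"
    have *: "norm (Blinfun (\<lambda>x. c *\<^sub>C blinfun_apply g x)) \<le> cmod c * norm g"
      for c and g :: "'a \<Rightarrow>\<^sub>L 'b"
    proof (rule norm_blinfun_bound)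
      fix x
      show "norm (Blinfun (\<lambda>x. c *\<^sub>C blinfun_apply g x) x) \<le> cmod c * norm g * norm x"
        using mult_left_mono[OF norm_blinfun[of g x], of "cmod c"]
        by (simp add: scaleC_apply_aux norm_scaleC mult.assoc)
    qed simp
    show "norm (Blinfun (\<lambda>x. a *\<^sub>C blinfun_apply f x)) = cmod a * norm f"
    proof (cases "a = 0")
      case True
      then show ?thesis using *[of 0 f] by simp
    next
      case False
      let ?g = "Blinfun (\<lambda>x. a *\<^sub>C blinfun_apply f x)"
      have "Blinfun (\<lambda>x. inverse a *\<^sub>C blinfun_apply ?g x) = f"
        using False by (simp add: scaleC_apply_aux blinfun_apply_inverse)
      then have "norm f \<le> cmod (inverse a) * norm ?g"
        using *[of "inverse a" ?g] by simp
      then have "cmod a * norm f \<le> cmod a * (cmod (inverse a) * norm ?g)"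
        by (rule mult_left_mono) simp
      also have "\<dots> = norm ?g"
        using False by (simp add: norm_inverse)
      finally have "cmod a * norm f \<le> norm ?g" .
      with *[of a f] show ?thesis by simp
    qed
  qed
qed

end

lemma cblinfun_apply_compose: "cblinfun_apply (f o\<^sub>C\<^sub>L g) x = cblinfun_apply f (cblinfun_apply g x)"
  by transfer simp

lemma clinear_cblinfun_apply: "clinear (cblinfun_apply f)"
  by transfer simp

lemma norm_cblinfun_onorm: "norm f = onorm (cblinfun_apply f)"
  by transfer (simp add: norm_blinfun.rep_eq)

instance cblinfun :: (complex_normed_vector, complex_banach) complex_banach
proof
  fix X :: "nat \<Rightarrow> 'a \<Rightarrow>\<^sub>C\<^sub>L 'b"
  assume X: "Cauchy X"
  let ?Y = "\<lambda>n. blinfun_of_cblinfun (X n)"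
  have dist_eq: "dist (blinfun_of_cblinfun f) (blinfun_of_cblinfun g) = dist f g"
    for f g :: "'a \<Rightarrow>\<^sub>C\<^sub>L 'b"
    by (simp add: dist_norm norm_cblinfun.rep_eq minus_cblinfun.rep_eq)
  have "Cauchy ?Y"
    using X by (simp add: Cauchy_def dist_eq)
  then obtain L where L: "?Y \<longlonglongrightarrow> L"
    by (auto simp: Cauchy_convergent_iff convergent_def)
  have lim: "(\<lambda>n. blinfun_apply (?Y n) x) \<longlonglongrightarrow> blinfun_apply L x" for x
    by (intro tendsto_intros L)
  have lin: "clinear (blinfun_apply (?Y n))" for n
    using blinfun_of_cblinfun by blast
  have "blinfun_apply L (c *\<^sub>C x) = c *\<^sub>C blinfun_apply L x" for c x
  proof (rule LIMSEQ_unique)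
    show "(\<lambda>n. blinfun_apply (?Y n) (c *\<^sub>C x)) \<longlonglongrightarrow> blinfun_apply L (c *\<^sub>C x)"
      by (rule lim)
    show "(\<lambda>n. blinfun_apply (?Y n) (c *\<^sub>C x)) \<longlonglongrightarrow> c *\<^sub>C blinfun_apply L x"
      using lin bounded_linear.tendsto[OF bounded_linear_scaleC lim] by (simp add: clinear_iff)
  qed
  then have "clinear (blinfun_apply L)"
    by (simp add: clinear_iff blinfun.bilinear_simps)
  then have "blinfun_of_cblinfun (Abs_cblinfun L) = L"
    by (simp add: Abs_cblinfun_inverse)
  then have "(\<lambda>n. dist (X n) (Abs_cblinfun L)) = (\<lambda>n. dist (?Y n) L)"
    by (metis dist_eq)
  then have "X \<longlonglongrightarrow> Abs_cblinfun L"
    using L tendsto_dist_iff[of ?Y L] tendsto_dist_iff[of X "Abs_cblinfun L"] by metis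
  then show "convergent X"
    by (auto simp: convergent_def)
qed


section \<open>Reflexivity\<close>

text \<open>The canonical isometric embedding into the bidual is onto.\<close>

definition reflexive_space :: "'a::complex_banach itself \<Rightarrow> bool"
  where "reflexive_space _ \<longleftrightarrow>
    (\<forall>F :: (('a \<Rightarrow>\<^sub>C\<^sub>L complex) \<Rightarrow>\<^sub>C\<^sub>L complex). \<exists>x::'a. \<forall>f.
       cblinfun_apply F f = cblinfun_apply f x)"


section \<open>Subsymmetric Schauder bases\<close>

definition schauder_basis :: "(nat \<Rightarrow> 'a::complex_banach) \<Rightarrow> bool"
  where "schauder_basis b \<longleftrightarrow> (\<forall>x. \<exists>!a :: nat \<Rightarrow> complex. (\<lambda>n. a n *\<^sub>C b n) sums x)"

definition unconditional_basis :: "(nat \<Rightarrow> 'a::complex_banach) \<Rightarrow> bool"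
  where "unconditional_basis b \<longleftrightarrow> schauder_basis b \<and>
    (\<forall>a :: nat \<Rightarrow> complex. summable (\<lambda>n. a n *\<^sub>C b n) \<longrightarrow>
       (\<forall>\<pi>. bij \<pi> \<longrightarrow> summable (\<lambda>n. a (\<pi> n) *\<^sub>C b (\<pi> n))))"

definition equivalent_seqs ::
  "(nat \<Rightarrow> 'a::complex_banach) \<Rightarrow> (nat \<Rightarrow> 'b::complex_banach) \<Rightarrow> bool"
  where "equivalent_seqs b c \<longleftrightarrow>
    (\<forall>a :: nat \<Rightarrow> complex. summable (\<lambda>n. a n *\<^sub>C b n) \<longleftrightarrow> summable (\<lambda>n. a n *\<^sub>C c n))"

definition subsymmetric_basis :: "(nat \<Rightarrow> 'a::complex_banach) \<Rightarrow> bool"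
  where "subsymmetric_basis b \<longleftrightarrow> unconditional_basis b \<and>
    (\<forall>\<sigma> :: nat \<Rightarrow> nat. strict_mono \<sigma> \<longrightarrow> equivalent_seqs (\<lambda>n. b (\<sigma> n)) b)"


section \<open>The space of p-integrable functions on the unit interval\<close>

definition Lp_functions :: "real \<Rightarrow> (real \<Rightarrow> complex) set"
  where "Lp_functions p =
    {f \<in> borel_measurable (lebesgue_on {0..1}).
       integrable (lebesgue_on {0..1}) (\<lambda>t. cmod (f t) powr p)}"

definition Lp_norm :: "real \<Rightarrow> (real \<Rightarrow> complex) \<Rightarrow> real"
  where "Lp_norm p f = (\<integral>t. cmod (f t) powr p \<partial>lebesgue_on {0..1}) powr (1 / p)"

definition Lp_space :: "real \<Rightarrow> (real \<Rightarrow> complex) set set"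
  where "Lp_space p = Lp_functions p //
    {(f, g). f \<in> Lp_functions p \<and> g \<in> Lp_functions p \<and> (AE t in lebesgue_on {0..1}. f t = g t)}"

text \<open>
  As the exponent is a variable, the space of almost-everywhere classes cannot itself be a type
  of class \<^class>\<open>complex_banach\<close>. That a type is this space is expressed by a bijection with the
  set of classes which carries the vector space operations and the norm of the type to the
  usual ones, computed on arbitrary representatives.
\<close>

definition is_Lp_space :: "real \<Rightarrow> 'a::complex_banach itself \<Rightarrow> bool"
  where "is_Lp_space p _ \<longleftrightarrow>
    (\<exists>J :: 'a \<Rightarrow> (real \<Rightarrow> complex) set.
       bij_betw J UNIV (Lp_space p) \<and>
       (\<forall>x y. \<forall>f\<in>J x. \<forall>g\<in>J y. (\<lambda>t. f t + g t) \<in> J (x + y)) \<and>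
       (\<forall>c x. \<forall>f\<in>J x. (\<lambda>t. c * f t) \<in> J (c *\<^sub>C x)) \<and>
       (\<forall>x. \<forall>f\<in>J x. norm x = Lp_norm p f))"


section \<open>Homomorphisms between algebras of operators\<close>

definition algebra_hom ::
  "(('a::complex_normed_vector \<Rightarrow>\<^sub>C\<^sub>L 'a) \<Rightarrow> ('b::complex_normed_vector \<Rightarrow>\<^sub>C\<^sub>L 'b)) \<Rightarrow> bool"
  where "algebra_hom \<phi> \<longleftrightarrow> clinear \<phi> \<and> (\<forall>S T. \<phi> (S o\<^sub>C\<^sub>L T) = \<phi> S o\<^sub>C\<^sub>L \<phi> T)"

definition banach_algebra_iso ::
  "(('a::complex_normed_vector \<Rightarrow>\<^sub>C\<^sub>L 'a) \<Rightarrow> ('b::complex_normed_vector \<Rightarrow>\<^sub>C\<^sub>L 'b)) \<Rightarrow> bool"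
  where "banach_algebra_iso \<phi> \<longleftrightarrow>
    algebra_hom \<phi> \<and> (\<exists>\<psi>. homeomorphism UNIV UNIV \<phi> \<psi>)"

definition rank_one_idempotent :: "('a::complex_normed_vector \<Rightarrow>\<^sub>C\<^sub>L 'a) \<Rightarrow> bool"
  where "rank_one_idempotent P \<longleftrightarrow>
    P o\<^sub>C\<^sub>L P = P \<and> complex_vector.dim (range (cblinfun_apply P)) = 1"

end

theory Submission
  imports Defs "HOL-Probability.Infinite_Product_Measure"
begin

text \<open>
  Fix a rank one idempotent \<open>P = x\<^sub>0 \<otimes> f\<^sub>0\<close> of X and a vector \<open>y\<^sub>0\<close> spanning the range of \<open>\<phi> P\<close>.
  The operator \<open>T x = \<phi> (x \<otimes> f\<^sub>0) y\<^sub>0\<close> intertwines: \<open>\<phi> A T = T A\<close>. Since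
  \<open>\<phi> (x\<^sub>0 \<otimes> f) T x = f x y\<^sub>0\<close>, it is bounded below once functionals of norm one detect the norm of
  X up to a constant; so its range is closed, and it contains the range of \<open>\<phi> W\<close> for every W of
  finite rank.

  Suppose X carries operators \<open>U\<^sub>s\<close>, \<open>V\<^sub>s\<close>, indexed by an uncountable set, with \<open>V\<^sub>s U\<^sub>s = 1\<close> and with
  \<open>V\<^sub>s U\<^sub>t\<close> of finite rank for distinct s and t. If \<open>\<phi> 1 y\<close> were not in the range of T, then
  \<open>\<phi> (V\<^sub>s)\<close> would keep \<open>\<phi> (U\<^sub>s) y\<close> and \<open>\<phi> (U\<^sub>t) y\<close> apart, and uncountably many s with a common bound
  on the norm of \<open>\<phi> (V\<^sub>s)\<close> would contradict the separability of Y. So \<open>\<phi> 1\<close> maps into the range of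
  T, every \<open>\<phi> A\<close> does, T is onto because some \<open>\<phi> A\<close> has dense range, and \<open>\<phi>\<close> is conjugation by T.

  The indices s are 0-1-sequences, sent to an almost disjoint family of infinite sets of natural
  numbers. For a subsymmetric basis, \<open>U\<^sub>s\<close> spreads the coefficients over the set of s, and \<open>V\<^sub>s\<close> collects
  them again. For \<open>L\<^sub>p[0,1]\<close>, binary digits turn the unit interval into a space of coin tosses;
  \<open>U\<^sub>s\<close> lets a function read only the tosses in the set of s, and \<open>V\<^sub>s\<close> averages over all other tosses.
\<close>

section \<open>Bounded operators\<close>

definition cblinfun_of :: "('a::complex_normed_vector \<Rightarrow> 'b::complex_normed_vector) \<Rightarrow> 'a \<Rightarrow>\<^sub>C\<^sub>L 'b"
  where "cblinfun_of f = Abs_cblinfun (Blinfun f)"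

lemma cblinfun_of_apply:
  assumes "clinear f" "bounded_linear f"
  shows "cblinfun_apply (cblinfun_of f) = f"
  using assms
  by (simp add: cblinfun_of_def cblinfun_apply.rep_eq Abs_cblinfun_inverse
      bounded_linear_Blinfun_apply)

lemma clinear_scaleR: "clinear f \<Longrightarrow> f (r *\<^sub>R x) = r *\<^sub>R f x"
  by (simp add: clinear_iff scaleR_scaleC)

lemma bounded_linear_if_clinear:
  assumes "clinear f" "\<And>x. norm (f x) \<le> K * norm x"
  shows "bounded_linear f"
  using assms by (intro bounded_linear_intro[where K = K])
    (auto simp: clinear_scaleR clinear_iff mult.commute)

lemma cblinfun_of_apply_bound:
  assumes "clinear f" "\<And>x. norm (f x) \<le> K * norm x"
  shows "cblinfun_apply (cblinfun_of f) = f"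
  by (rule cblinfun_of_apply[OF assms(1) bounded_linear_if_clinear[OF assms]])

lemma bounded_linear_cblinfun_apply: "bounded_linear (cblinfun_apply F)"
  by transfer (rule blinfun.bounded_linear_right)

lemma norm_cblinfun_apply_le: "norm (cblinfun_apply F x) \<le> norm F * norm x"
  by transfer (rule norm_blinfun)

lemma norm_cblinfun_le:
  assumes "0 \<le> K" "\<And>x. norm (cblinfun_apply F x) \<le> K * norm x"
  shows "norm F \<le> K"
  using assms by transfer (rule norm_blinfun_bound)

lemma cblinfun_apply_add_right: "cblinfun_apply F (x + y) = cblinfun_apply F x + cblinfun_apply F y"
  and cblinfun_apply_scaleC_right: "cblinfun_apply F (c *\<^sub>C x) = c *\<^sub>C cblinfun_apply F x"
  using clinear_cblinfun_apply[of F] by (simp_all add: clinear_iff)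

lemma cblinfun_apply_diff_right: "cblinfun_apply F (x - y) = cblinfun_apply F x - cblinfun_apply F y"
  by (rule linear_diff[OF bounded_linear.linear[OF bounded_linear_cblinfun_apply]])

lemma cblinfun_apply_zero_right [simp]: "cblinfun_apply F 0 = 0"
  by (rule linear_0[OF bounded_linear.linear[OF bounded_linear_cblinfun_apply]])

lemma cblinfun_apply_zero [simp]: "cblinfun_apply 0 x = 0"
  by transfer simp

text \<open>The lower bound on \<open>T\<close> is an upper bound on its set-theoretic inverse, so
  boundedness of the inverse needs no open mapping argument.\<close>

lemma cblinfun_of_bij:
  fixes T :: "'a::complex_normed_vector \<Rightarrow>\<^sub>C\<^sub>L 'b::complex_normed_vector"
  assumes c: "c > 0" "\<And>x. c * norm x \<le> norm (cblinfun_apply T x)" and surj: "surj (cblinfun_apply T)"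
  obtains S where "\<And>x. cblinfun_apply S (cblinfun_apply T x) = x" "\<And>y. cblinfun_apply T (cblinfun_apply S y) = y"
proof -
  have inj: "inj (cblinfun_apply T)"
  proof
    fix x y assume "cblinfun_apply T x = cblinfun_apply T y"
    then have "cblinfun_apply T (x - y) = 0" by (simp add: cblinfun_apply_diff_right)
    with c(2)[of "x - y"] c(1) show "x = y" by (simp add: mult_le_0_iff)
  qed
  define S where "S = inv (cblinfun_apply T)"
  have ST: "S (cblinfun_apply T x) = x" for x by (simp add: S_def inj)
  have TS: "cblinfun_apply T (S y) = y" for y by (simp add: S_def surj surj_f_inv_f)
  have "clinear S"
    unfolding clinear_iff
    by (metis ST TS cblinfun_apply_add_right cblinfun_apply_scaleC_right)
  moreover have "norm (S y) \<le> (1 / c) * norm y" for y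
    using c(2)[of "S y"] c(1) by (simp add: TS field_simps)
  ultimately have "cblinfun_apply (cblinfun_of S) = S" by (rule cblinfun_of_apply_bound)
  with that[of "cblinfun_of S"] ST TS show ?thesis by simp
qed

lemma norm_cblinfun_compose: "norm (F o\<^sub>C\<^sub>L G) \<le> norm F * norm G"
proof (rule norm_cblinfun_le)
  fix x
  have "norm (cblinfun_apply F (cblinfun_apply G x)) \<le> norm F * norm (cblinfun_apply G x)"
    by (rule norm_cblinfun_apply_le)
  also have "\<dots> \<le> norm F * (norm G * norm x)"
    by (intro mult_left_mono norm_cblinfun_apply_le) simp
  finally show "norm (cblinfun_apply (F o\<^sub>C\<^sub>L G) x) \<le> norm F * norm G * norm x"
    by (simp add: cblinfun_apply_compose mult.assoc)
qed simp

lemma continuous_on_conjugation: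
  "continuous_on UNIV (\<lambda>B. S o\<^sub>C\<^sub>L (B o\<^sub>C\<^sub>L T))"
proof -
  have "bounded_linear (\<lambda>B. S o\<^sub>C\<^sub>L (B o\<^sub>C\<^sub>L T))"
  proof (rule bounded_linear_if_clinear)
    show "clinear (\<lambda>B. S o\<^sub>C\<^sub>L (B o\<^sub>C\<^sub>L T))"
      by (auto simp: clinear_iff cblinfun_apply_compose cblinfun_apply_add cblinfun_apply_scaleC
          cblinfun_apply_add_right cblinfun_apply_scaleC_right intro!: cblinfun_eqI)
    show "norm (S o\<^sub>C\<^sub>L (B o\<^sub>C\<^sub>L T)) \<le> (norm S * norm T) * norm B" for B
      using order_trans[OF norm_cblinfun_compose mult_left_mono[OF norm_cblinfun_compose norm_ge_zero]]
      by (metis mult.assoc mult.commute)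
  qed
  then show ?thesis by (rule linear_continuous_on)
qed

lemma closed_range_if_bounded_below:
  fixes T :: "'a::complex_banach \<Rightarrow>\<^sub>C\<^sub>L 'b::complex_normed_vector"
  assumes c: "c > 0" "\<And>x. c * norm x \<le> norm (cblinfun_apply T x)"
  shows "closed (range (cblinfun_apply T))"
proof -
  have "complete (cblinfun_apply T ` UNIV)"
    by (rule complete_isometric_image[OF c(1) subspace_UNIV bounded_linear_cblinfun_apply])
      (use c in \<open>auto simp: complete_UNIV\<close>)
  then show ?thesis by (rule complete_imp_closed)
qed

section \<open>Rank one operators and their span\<close>

definition rank_one_op :: "'b::complex_normed_vector \<Rightarrow> ('a::complex_normed_vector \<Rightarrow>\<^sub>C\<^sub>L complex) \<Rightarrow> 'a \<Rightarrow>\<^sub>C\<^sub>L 'b"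
  where "rank_one_op x f = cblinfun_of (\<lambda>y. cblinfun_apply f y *\<^sub>C x)"

lemma norm_rank_one_le: "norm (cblinfun_apply f y *\<^sub>C x) \<le> (norm f * norm x) * norm y"
  using mult_right_mono[OF norm_cblinfun_apply_le[of f y], of "norm x"]
  by (simp add: norm_scaleC mult_ac)

lemma rank_one_op_apply: "cblinfun_apply (rank_one_op x f) y = cblinfun_apply f y *\<^sub>C x"
proof -
  have "clinear (\<lambda>y. cblinfun_apply f y *\<^sub>C x)"
    by (simp add: clinear_iff cblinfun_apply_add_right cblinfun_apply_scaleC_right
        scaleC_add_left scaleC_scaleC scaleC_complex_def)
  from cblinfun_of_apply_bound[OF this norm_rank_one_le] show ?thesis
    by (simp add: rank_one_op_def)
qed

lemma norm_rank_one_op: "norm (rank_one_op x f) \<le> norm f * norm x"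
  by (rule norm_cblinfun_le) (simp_all only: rank_one_op_apply norm_rank_one_le zero_le_mult_iff norm_ge_zero simp_thms)

text \<open>Taking the span of the operators \<open>rank_one_op x f\<close>, rather than a condition
  on the dimension of the range, allows induction along the span.\<close>

definition finite_rank_ops :: "('a::complex_normed_vector \<Rightarrow>\<^sub>C\<^sub>L 'b::complex_normed_vector) set"
  where "finite_rank_ops = complex_vector.span {rank_one_op x f | x f. True}"

lemma compose_rank_one_op: "F o\<^sub>C\<^sub>L rank_one_op x f = rank_one_op (cblinfun_apply F x) f"
  by (rule cblinfun_eqI) (simp add: cblinfun_apply_compose rank_one_op_apply cblinfun_apply_scaleC_right)

lemma rank_one_op_scaleC: "rank_one_op (c *\<^sub>C x) f = c *\<^sub>C rank_one_op x f"
  by (rule cblinfun_eqI)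
    (simp add: rank_one_op_apply cblinfun_apply_scaleC scaleC_scaleC mult.commute)

lemma rank_one_op_add: "rank_one_op (x + y) f = rank_one_op x f + rank_one_op y f"
  by (rule cblinfun_eqI) (simp add: rank_one_op_apply cblinfun_apply_add scaleC_add_right)

lemma clinear_continuous_bounded:
  assumes "clinear f" "continuous_on UNIV f"
  obtains K where "K > 0" "\<And>x. norm (f x) \<le> K * norm x"
proof -
  have f0: "f 0 = 0"
    using assms(1) by (metis clinear_iff complex_vector.scale_zero_left)
  have "isCont f 0"
    using assms(2) by (simp add: continuous_on_eq_continuous_at)
  then obtain d where d: "d > 0" "\<And>x. norm x < d \<Longrightarrow> norm (f x) < 1"
    unfolding continuous_at_eps_delta using f0 by (metis dist_0_norm dist_commute zero_less_one)
  \<comment> \<open>Scaling \<open>x\<close> to norm \<open>d / 2\<close> puts it strictly inside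
    the ball of radius \<open>d\<close>, whence the factor 2.\<close>
  have "norm (f x) \<le> (2 / d) * norm x" for x
  proof (cases "x = 0")
    case False
    define r where "r = d / (2 * norm x)"
    have r: "r > 0" using False d by (simp add: r_def)
    have "norm (r *\<^sub>R x) < d" using False d(1) by (simp add: r_def)
    then have "norm (f (r *\<^sub>R x)) < 1" by (rule d)
    then have "r * norm (f x) < 1"
      using r by (simp add: clinear_scaleR[OF assms(1)])
    then show ?thesis using False d(1) by (simp add: r_def field_simps)
  qed (simp add: f0)
  with that[of "2 / d"] d(1) show ?thesis by simp
qed

lemma dim_one_obtains:
  assumes "complex_vector.dim S = 1"
  obtains y where "y \<in> S" "y \<noteq> 0" "S \<subseteq> range (\<lambda>k. k *\<^sub>C y)"
proof -
  obtain B where B: "B \<subseteq> S" "complex_vector.independent B" "S \<subseteq> complex_vector.span B" "card B = 1"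
    using complex_vector.basis_exists[of S] assms by metis
  then obtain y where y: "B = {y}" by (auto simp: card_1_singleton_iff)
  with B that[of y] show ?thesis
    by (auto simp: complex_vector.span_singleton complex_vector.dependent_zero)
qed

lemma rank_one_idempotent_rank_one_op:
  assumes "cblinfun_apply f x = 1"
  shows "rank_one_idempotent (rank_one_op x f)"
proof -
  have x: "x \<noteq> 0" using assms by auto
  have "range (cblinfun_apply (rank_one_op x f)) = complex_vector.span {x}"
  proof -
    have "k *\<^sub>C x \<in> range (\<lambda>y. cblinfun_apply f y *\<^sub>C x)" for k
      using assms by (intro range_eqI[of _ _ "k *\<^sub>C x"]) (simp add: cblinfun_apply_scaleC_right scaleC_complex_def)
    then show ?thesis
      by (auto simp: complex_vector.span_singleton rank_one_op_apply[abs_def])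
  qed
  then have "complex_vector.dim (range (cblinfun_apply (rank_one_op x f))) = 1"
    using complex_vector.dim_eq_card_independent[of "{x}"] x
    by (simp add: complex_vector.dim_span)
  then show ?thesis
    using assms by (simp add: rank_one_idempotent_def compose_rank_one_op rank_one_op_apply scaleC_one)
qed

section \<open>Separability\<close>

text \<open>Each \<open>z s\<close> is within \<open>e / 2\<close> of a point \<open>d s\<close> of
  a countable dense set. As \<open>d\<close> cannot be injective on \<open>S\<close>, two indices
  share that point.\<close>

lemma separable_uncountable_close:
  fixes z :: "'i \<Rightarrow> 'b::metric_space"
  assumes sep: "separable_space (euclidean :: 'b topology)" and S: "uncountable S" and e: "e > 0"
  shows "\<exists>s\<in>S. \<exists>t\<in>S. s \<noteq> t \<and> dist (z s) (z t) < e"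
proof -
  obtain C :: "'b set" where C: "countable C" "closure C = UNIV"
    using sep by (auto simp: separable_space_def)
  have "\<exists>d\<in>C. dist d (z s) < e / 2" for s
    using C(2) e closure_approachable[of "z s" C] by (metis UNIV_I half_gt_zero)
  then obtain d where d: "\<And>s. d s \<in> C" "\<And>s. dist (d s) (z s) < e / 2" by metis
  have "\<not> inj_on d S"
    using S countable_image_inj_on[of d S] countable_subset[OF _ C(1), of "d ` S"] d(1) by (metis image_subsetI)
  then obtain s t where st: "s \<in> S" "t \<in> S" "s \<noteq> t" "d s = d t" by (auto simp: inj_on_def)
  with d(2)[of s] d(2)[of t] show ?thesis
    by (metis dist_commute dist_triangle_half_r)
qed

lemma uncountable_bounded_subset:
  fixes g :: "'i \<Rightarrow> real"
  assumes "uncountable S"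
  obtains N :: nat where "uncountable {s \<in> S. g s \<le> real N}"
proof -
  have "uncountable (\<Union>N. {s \<in> S. g s \<le> real N})"
    using assms real_arch_simple by (auto elim!: contrapos_nn countable_subset[rotated])
  then show ?thesis using that countable_UN[of UNIV "\<lambda>N. {s \<in> S. g s \<le> real N}"] by blast
qed

lemma uncountable_UNIV_fun_bool: "uncountable (UNIV :: (nat \<Rightarrow> bool) set)"
proof
  assume "countable (UNIV :: (nat \<Rightarrow> bool) set)"
  then obtain g :: "nat \<Rightarrow> nat \<Rightarrow> bool" where "range g = UNIV"
    by (metis uncountable_def UNIV_not_empty)
  then obtain n where "g n = (\<lambda>n. \<not> g n n)" by (metis surjD)
  then show False by (metis (full_types))
qed

section \<open>Homomorphisms that preserve rank one idempotents\<close>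

text \<open>The conclusion of the Hahn-Banach theorem up to a constant factor \<open>c\<close>. It
  is what makes the intertwiner \<open>T\<close> bounded below.\<close>

definition norming_dual :: "'a::complex_normed_vector itself \<Rightarrow> bool"
  where "norming_dual _ \<longleftrightarrow> (\<exists>c>0. \<forall>x::'a. \<exists>f. norm f \<le> 1 \<and> c * norm x \<le> cmod (cblinfun_apply f x))"

text \<open>The operator \<open>U s\<close> embeds a copy of the space, complemented by the
  projection \<open>U s\<close> after \<open>V s\<close>. Modulo finite rank, the projections for
  distinct indices annihilate each other.\<close>

definition almost_orthogonal_copies ::
    "((nat \<Rightarrow> bool) \<Rightarrow> ('a::complex_normed_vector \<Rightarrow>\<^sub>C\<^sub>L 'a)) \<Rightarrow> ((nat \<Rightarrow> bool) \<Rightarrow> ('a \<Rightarrow>\<^sub>C\<^sub>L 'a)) \<Rightarrow> bool"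
  where "almost_orthogonal_copies U V \<longleftrightarrow>
    (\<forall>s x. cblinfun_apply (V s) (cblinfun_apply (U s) x) = x) \<and>
    (\<forall>s t. s \<noteq> t \<longrightarrow> V s o\<^sub>C\<^sub>L U t \<in> finite_rank_ops)"

theorem banach_algebra_iso_if_copies:
  fixes \<phi> :: "('a::complex_banach \<Rightarrow>\<^sub>C\<^sub>L 'a) \<Rightarrow> ('b::complex_banach \<Rightarrow>\<^sub>C\<^sub>L 'b)"
  assumes nz: "\<exists>x::'a. x \<noteq> 0"
    and sep: "separable_space (euclidean :: 'b topology)"
    and norming: "norming_dual TYPE('a)"
    and copies: "almost_orthogonal_copies U (V :: (nat \<Rightarrow> bool) \<Rightarrow> ('a \<Rightarrow>\<^sub>C\<^sub>L 'a))"
    and hom: "algebra_hom \<phi>"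
    and cont: "continuous_on UNIV \<phi>"
    and dense: "\<exists>T\<in>range \<phi>. closure (range (cblinfun_apply T)) = UNIV"
    and rank_one: "\<And>P. rank_one_idempotent P \<Longrightarrow> rank_one_idempotent (\<phi> P)"
  shows "banach_algebra_iso \<phi>"
proof -
  let ?a = cblinfun_apply
  have lin: "clinear \<phi>" and mult: "\<phi> (S o\<^sub>C\<^sub>L T) = \<phi> S o\<^sub>C\<^sub>L \<phi> T" for S T
    using hom by (auto simp: algebra_hom_def)
  have phi_add: "\<phi> (S + T) = \<phi> S + \<phi> T" and phi_scaleC: "\<phi> (k *\<^sub>C S) = k *\<^sub>C \<phi> S" for S T k
    using lin by (auto simp: clinear_iff)
  have mult_apply: "?a (\<phi> (S o\<^sub>C\<^sub>L T)) y = ?a (\<phi> S) (?a (\<phi> T) y)" for S T y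
    by (simp add: mult cblinfun_apply_compose)
  obtain K where K: "K > 0" "\<And>A. norm (\<phi> A) \<le> K * norm A"
    using clinear_continuous_bounded[OF lin cont] by blast
  obtain c where c: "c > 0"
    and nf: "\<And>x::'a. \<exists>f. norm f \<le> 1 \<and> c * norm x \<le> cmod (?a f x)"
    using norming by (auto simp: norming_dual_def)

  obtain x0 :: 'a and f0 :: "'a \<Rightarrow>\<^sub>C\<^sub>L complex" where f0: "?a f0 x0 = 1"
  proof -
    obtain x :: 'a and f where "x \<noteq> 0" "c * norm x \<le> cmod (?a f x)" using nz nf by blast
    then have "?a f x \<noteq> 0" using c by (auto simp: mult_le_0_iff)
    then have "?a f ((1 / ?a f x) *\<^sub>C x) = 1"
      by (simp add: cblinfun_apply_scaleC_right scaleC_complex_def)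
    then show ?thesis using that by blast
  qed
  define P where "P = rank_one_op x0 f0"
  have "rank_one_idempotent (\<phi> P)"
    unfolding P_def by (rule rank_one[OF rank_one_idempotent_rank_one_op[OF f0]])
  then have PP: "\<phi> P o\<^sub>C\<^sub>L \<phi> P = \<phi> P" and "complex_vector.dim (range (?a (\<phi> P))) = 1"
    by (auto simp: rank_one_idempotent_def)
  from dim_one_obtains[OF this(2)] obtain y0
    where y0: "y0 \<in> range (?a (\<phi> P))" "y0 \<noteq> 0" "range (?a (\<phi> P)) \<subseteq> range (\<lambda>k. k *\<^sub>C y0)"
    by blast
  \<comment> \<open>An idempotent fixes its range pointwise.\<close>
  have Py0: "?a (\<phi> P) y0 = y0"
    using y0(1) PP by (metis (no_types, lifting) cblinfun_apply_compose imageE)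

  define T where "T = cblinfun_of (\<lambda>x. ?a (\<phi> (rank_one_op x f0)) y0)"
  have T: "?a T x = ?a (\<phi> (rank_one_op x f0)) y0" for x
  proof -
    have "clinear (\<lambda>x. ?a (\<phi> (rank_one_op x f0)) y0)"
      by (simp add: clinear_iff rank_one_op_add rank_one_op_scaleC phi_add phi_scaleC
          cblinfun_apply_add cblinfun_apply_scaleC)
    moreover have "norm (?a (\<phi> (rank_one_op x f0)) y0) \<le> (K * norm f0 * norm y0) * norm x" for x
    proof -
      have "norm (?a (\<phi> (rank_one_op x f0)) y0) \<le> norm (\<phi> (rank_one_op x f0)) * norm y0"
        by (rule norm_cblinfun_apply_le)
      also have "\<dots> \<le> (K * (norm f0 * norm x)) * norm y0"
        using K norm_rank_one_op[of x f0]
        by (intro mult_right_mono) (auto intro: order_trans[OF K(2)] mult_left_mono)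
      finally show ?thesis by (simp add: mult_ac)
    qed
    ultimately show ?thesis unfolding T_def by (subst cblinfun_of_apply_bound) auto
  qed
  have intertwine: "?a (\<phi> A) (?a T x) = ?a T (?a A x)" for A x
    by (simp add: T mult_apply[symmetric] compose_rank_one_op)
  \<comment> \<open>The operator \<open>rank_one_op x0 f\<close> after
    \<open>rank_one_op x f0\<close> is \<open>f x\<close> times \<open>P\<close>, and
    \<open>\<phi> P\<close> fixes \<open>y0\<close>.\<close>
  have recover: "?a (\<phi> (rank_one_op x0 f)) (?a T x) = ?a f x *\<^sub>C y0" for f x
    by (simp add: T mult_apply[symmetric] compose_rank_one_op rank_one_op_apply rank_one_op_scaleC
        phi_scaleC cblinfun_apply_scaleC flip: P_def) (simp add: Py0)
  have rank_one_into: "?a (\<phi> (rank_one_op x f)) y \<in> range (?a T)" for x f y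
  proof -
    obtain k where k: "?a (\<phi> P) (?a (\<phi> (rank_one_op x0 f)) y) = k *\<^sub>C y0" using y0(3) by blast
    \<comment> \<open>Inserting \<open>P\<close> into the factorisation forces the intermediate
      value into the line spanned by \<open>y0\<close>, where
      \<open>\<phi> (rank_one_op x f0)\<close> takes values of \<open>T\<close>.\<close>
    have "rank_one_op x f = rank_one_op x f0 o\<^sub>C\<^sub>L (P o\<^sub>C\<^sub>L rank_one_op x0 f)"
      by (simp add: P_def compose_rank_one_op rank_one_op_apply f0 scaleC_one)
    then have "?a (\<phi> (rank_one_op x f)) y = ?a T (k *\<^sub>C x)"
      by (simp add: mult_apply k T rank_one_op_scaleC phi_scaleC cblinfun_apply_scaleC
          cblinfun_apply_scaleC_right)
    then show ?thesis by simp
  qed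
  have finite_rank_into: "?a (\<phi> W) y \<in> range (?a T)" if "W \<in> finite_rank_ops" for W y
    using that unfolding finite_rank_ops_def
  proof (induction rule: complex_vector.span_induct_alt)
    case base
    have "\<phi> 0 = 0" using phi_scaleC[of 0 0] by simp
    then show ?case by (auto intro!: range_eqI[of _ _ 0])
  next
    case (step k S W)
    then obtain u v where "?a (\<phi> S) y = ?a T u" "?a (\<phi> W) y = ?a T v"
      using rank_one_into by blast
    then have "?a (\<phi> (k *\<^sub>C S + W)) y = ?a T (k *\<^sub>C u + v)"
      by (simp add: phi_add phi_scaleC cblinfun_apply_add cblinfun_apply_scaleC
          cblinfun_apply_add_right cblinfun_apply_scaleC_right)
    then show ?case by simp
  qed

  \<comment> \<open>Applying \<open>recover\<close> to a functional that norms \<open>x\<close> up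
    to \<open>c\<close> gives
    \<open>c * norm x * norm y0 \<le> K * norm x0 * norm (?a T x)\<close>.\<close>
  define c' where "c' = c * norm y0 / (K * norm x0)"
  have x0: "x0 \<noteq> 0" using f0 by auto
  have c': "c' > 0" using c K x0 y0(2) by (simp add: c'_def)
  have below: "c' * norm x \<le> norm (?a T x)" for x
  proof -
    obtain f where f: "norm f \<le> 1" "c * norm x \<le> cmod (?a f x)" using nf by blast
    have "c * norm x * norm y0 \<le> norm (?a f x *\<^sub>C y0)"
      using f(2) by (simp add: norm_scaleC mult_right_mono)
    also have "\<dots> \<le> norm (\<phi> (rank_one_op x0 f)) * norm (?a T x)"
      using recover[of f x] norm_cblinfun_apply_le by metis
    also have "\<dots> \<le> (K * (1 * norm x0)) * norm (?a T x)"
    proof (intro mult_right_mono order_trans[OF K(2)] mult_left_mono)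
      show "norm (rank_one_op x0 f) \<le> 1 * norm x0"
        by (rule order_trans[OF norm_rank_one_op mult_right_mono]) (use f in auto)
    qed (use K in auto)
    finally show ?thesis using K(1) x0 by (simp add: c'_def field_simps)
  qed
  have cl: "closed (range (?a T))" by (rule closed_range_if_bounded_below[OF c' below])

  have VU: "?a (V s) (?a (U s) x) = x"
    and VU': "s \<noteq> t \<Longrightarrow> V s o\<^sub>C\<^sub>L U t \<in> finite_rank_ops" for s t x
    using copies by (auto simp: almost_orthogonal_copies_def)
  \<comment> \<open>\<open>E\<close> is the identity of X. It is the same for every index, so
    \<open>\<phi> E\<close> factors through every pair \<open>V s\<close>,
    \<open>U s\<close>.\<close>
  define E where "E = V (\<lambda>_. True) o\<^sub>C\<^sub>L U (\<lambda>_. True)"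
  have VUE: "V s o\<^sub>C\<^sub>L U s = E" for s
    by (rule cblinfun_eqI) (simp add: E_def cblinfun_apply_compose VU)
  have EA: "E o\<^sub>C\<^sub>L A = A" for A
    by (rule cblinfun_eqI) (simp add: E_def cblinfun_apply_compose VU)
  have unit_into: "?a (\<phi> E) y \<in> range (?a T)" for y
  proof (rule ccontr)
    assume "?a (\<phi> E) y \<notin> range (?a T)"
    then have "- range (?a T) \<in> {S. open S \<and> ?a (\<phi> E) y \<in> S}" using cl by auto
    then obtain \<delta> where \<delta>: "\<delta> > 0" "\<And>w. dist w (?a (\<phi> E) y) < \<delta> \<Longrightarrow> w \<notin> range (?a T)"
      using open_dist by (metis (mono_tags, lifting) ComplD mem_Collect_eq)
    obtain N :: nat where N: "uncountable {s \<in> UNIV. norm (\<phi> (V s)) \<le> real N}"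
      using uncountable_bounded_subset[OF uncountable_UNIV_fun_bool] by metis
    \<comment> \<open>\<open>N\<close> may be 0, so the gap is divided by
      \<open>N + 1\<close>.\<close>
    have "\<delta> / (real N + 1) > 0" using \<delta> by simp
    from separable_uncountable_close[OF sep N this, of "\<lambda>s. ?a (\<phi> (U s)) y"]
    obtain s t where st: "s \<noteq> t" "norm (\<phi> (V s)) \<le> real N"
      and close: "dist (?a (\<phi> (U s)) y) (?a (\<phi> (U t)) y) < \<delta> / (real N + 1)"
      by auto
    \<comment> \<open>As \<open>V s\<close> after \<open>U t\<close> has finite rank,
      \<open>?w\<close> lies in the range of \<open>T\<close>; the estimate places it within
      \<open>\<delta>\<close> of \<open>?a (\<phi> E) y\<close>.\<close>
    let ?w = "?a (\<phi> (V s o\<^sub>C\<^sub>L U t)) y"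
    have "dist ?w (?a (\<phi> E) y) = norm (?a (\<phi> (V s)) (?a (\<phi> (U s)) y - ?a (\<phi> (U t)) y))"
      by (simp add: VUE[of s, symmetric] mult_apply dist_norm cblinfun_apply_diff_right norm_minus_commute)
    also have "\<dots> \<le> norm (\<phi> (V s)) * norm (?a (\<phi> (U s)) y - ?a (\<phi> (U t)) y)"
      by (rule norm_cblinfun_apply_le)
    also have "\<dots> \<le> (real N + 1) * norm (?a (\<phi> (U s)) y - ?a (\<phi> (U t)) y)"
      using st by (intro mult_right_mono) auto
    also have "\<dots> < \<delta>" using close by (simp add: dist_norm field_simps)
    finally have "?w \<notin> range (?a T)" by (rule \<delta>(2))
    with finite_rank_into[OF VU'[OF st(1)]] show False by blast
  qed
  have surj: "surj (?a T)"
  proof -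
    obtain A where A: "closure (range (?a (\<phi> A))) = UNIV" using dense by auto
    have "range (?a (\<phi> A)) \<subseteq> range (?a T)"
      using unit_into EA[of A] mult_apply[of E A] by (metis image_subsetI)
    then show ?thesis using A cl closure_minimal by blast
  qed
  obtain S where ST: "\<And>x. ?a S (?a T x) = x" and TS: "\<And>y. ?a T (?a S y) = y"
    using cblinfun_of_bij[OF c' below surj] by blast
  have phi_eq: "\<phi> A = T o\<^sub>C\<^sub>L (A o\<^sub>C\<^sub>L S)" for A
    by (rule cblinfun_eqI) (metis TS cblinfun_apply_compose intertwine)
  have "homeomorphism UNIV UNIV \<phi> (\<lambda>B. S o\<^sub>C\<^sub>L (B o\<^sub>C\<^sub>L T))"
  proof (rule homeomorphismI)
    show "S o\<^sub>C\<^sub>L (\<phi> A o\<^sub>C\<^sub>L T) = A" for A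
      by (rule cblinfun_eqI) (simp add: phi_eq cblinfun_apply_compose ST)
    show "\<phi> (S o\<^sub>C\<^sub>L (B o\<^sub>C\<^sub>L T)) = B" for B
      by (rule cblinfun_eqI) (simp add: phi_eq cblinfun_apply_compose TS)
  qed (use cont continuous_on_conjugation in auto)
  with hom show ?thesis by (auto simp: banach_algebra_iso_def)
qed

section \<open>Consequences of the Baire category theorem\<close>

text \<open>Zabreiko's lemma. It stands in for the open mapping and closed graph theorems.\<close>

lemma countably_subadditive_imp_bounded:
  fixes p :: "'a::banach \<Rightarrow> real"
  assumes scale: "\<And>r x. p (r *\<^sub>R x) \<le> \<bar>r\<bar> * p x"
    and sub: "\<And>X x. X sums x \<Longrightarrow> summable (\<lambda>n. p (X n)) \<Longrightarrow> p x \<le> (\<Sum>n. p (X n))"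
  obtains K where "K \<ge> 0" "\<And>x. p x \<le> K * norm x"
proof -
  have p0: "p 0 = 0"
  proof -
    have "p 0 \<le> 0" "p 0 \<le> \<bar>2\<bar> * p 0" using scale[of 0 0] scale[of 2 0] by simp_all
    then show ?thesis by simp
  qed
  \<comment> \<open>Finite subadditivity is countable subadditivity for a series that is zero after
    two terms.\<close>
  have add: "p (x + y) \<le> p x + p y" for x y
  proof -
    let ?X = "\<lambda>n::nat. if n = 0 then x else if n = 1 then y else 0"
    have sx: "?X sums (x + y)"
      using sums_finite[of "{0, 1}" ?X] by simp
    have "(\<lambda>n. p (?X n)) sums (p x + p y)"
      using sums_finite[of "{0, 1}" "\<lambda>n. p (?X n)"] by (simp add: p0)
    then show ?thesis using sub[OF sx] by (simp add: sums_iff)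
  qed
  have minus: "p (- x) \<le> p x" for x using scale[of "-1" x] by simp
  \<comment> \<open>The sublevel sets cover the space, so by Baire the closure of one of them
    contains a ball.\<close>
  let ?A = "\<lambda>n::nat. {x. p x \<le> real n}"
  have "\<exists>n. interior (closure (?A n)) \<noteq> {}"
  proof (rule ccontr)
    assume "\<nexists>n. interior (closure (?A n)) \<noteq> {}"
    then have "(euclidean :: 'a topology) interior_of \<Union>(range (\<lambda>n. closure (?A n))) = {}"
      by (intro Baire_category_alt) (auto simp: completely_metrizable_space_euclidean)
    moreover have "\<Union>(range (\<lambda>n. closure (?A n))) = UNIV"
      using real_arch_simple closure_subset by (auto simp: subset_eq) blast
    ultimately show False by simp
  qed
  then obtain n x0 r where r: "r > 0" "ball x0 r \<subseteq> closure (?A n)"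
    by (auto simp: mem_interior ex_in_conv[symmetric])
  \<comment> \<open>Half the difference of approximants to \<open>x0 + x\<close> and
    \<open>x0 - x\<close> approximates \<open>x\<close>, and \<open>p\<close> is still at most
    \<open>n\<close> there. This moves the ball from \<open>x0\<close> to the origin.\<close>
  have approx: "\<exists>u. p u \<le> real n \<and> norm (x - u) < e" if x: "norm x < r" and e: "e > 0" for x e
  proof -
    have "x0 + x \<in> closure (?A n)" "x0 - x \<in> closure (?A n)"
      using r(2) x by (auto simp: subset_eq dist_norm)
    then obtain u v where u: "p u \<le> real n" "norm (u - (x0 + x)) < e"
      and v: "p v \<le> real n" "norm (v - (x0 - x)) < e"
      using e unfolding closure_approachable dist_norm by blast
    let ?w = "(1/2) *\<^sub>R (u + - v)"
    have "p ?w \<le> real n"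
      using scale[of "1/2" "u + - v"] add[of u "- v"] minus[of v] u(1) v(1) by simp
    moreover have "norm (x - ?w) = (1/2) * norm ((v - (x0 - x)) - (u - (x0 + x)))"
    proof -
      have "x - ?w = (1/2) *\<^sub>R ((v - (x0 - x)) - (u - (x0 + x)))"
        by (simp add: scaleR_diff_right scaleR_add_right algebra_simps flip: scaleR_add_left)
      then show ?thesis by (metis norm_scaleR abs_of_pos half_gt_zero zero_less_one)
    qed
    moreover have "norm ((v - (x0 - x)) - (u - (x0 + x))) < e + e"
      using norm_triangle_ineq4[of "v - (x0 - x)" "u - (x0 + x)"] u(2) v(2) by linarith
    ultimately show ?thesis by (intro exI[of _ ?w]) auto
  qed
  \<comment> \<open>\<open>approx\<close> is used at norm \<open>r / 2\<close>; scaling back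
    multiplies the bound \<open>n\<close> by \<open>2 * norm x / r\<close>, and turns the error
    \<open>r / 4\<close> into half the norm of \<open>x\<close>.\<close>
  define M where "M = 2 * real n / r"
  have M: "M \<ge> 0" using r by (simp add: M_def)
  have "\<exists>u. p u \<le> M * norm x \<and> norm (x - u) \<le> norm x / 2" for x
  proof (cases "x = 0")
    case False
    define s where "s = r / (2 * norm x)"
    have s: "s > 0" using False r by (simp add: s_def)
    have "norm (s *\<^sub>R x) < r" using False r by (simp add: s_def)
    from approx[OF this, of "r / 4"] r obtain u where u: "p u \<le> real n" "norm (s *\<^sub>R x - u) < r / 4"
      by auto
    have "p ((1/s) *\<^sub>R u) \<le> (1/s) * real n"
      using scale[of "1/s" u] s u(1) mult_left_mono[OF u(1), of "1/s"] by simp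
    also have "\<dots> = M * norm x" using False r by (simp add: s_def M_def)
    finally have "p ((1/s) *\<^sub>R u) \<le> M * norm x" .
    moreover have "norm (x - (1/s) *\<^sub>R u) \<le> norm x / 2"
    proof -
      have "x - (1/s) *\<^sub>R u = (1/s) *\<^sub>R (s *\<^sub>R x - u)" using s by (simp add: scaleR_diff_right)
      then have "norm (x - (1/s) *\<^sub>R u) = (1/s) * norm (s *\<^sub>R x - u)" using s by simp
      also have "\<dots> \<le> (1/s) * (r/4)" using s u(2) by (intro mult_left_mono) auto
      also have "\<dots> = norm x / 2" using False r by (simp add: s_def)
      finally show ?thesis .
    qed
    ultimately show ?thesis by blast
  qed (auto simp: p0)
  then obtain u where u: "\<And>x. p (u x) \<le> M * norm x" "\<And>x. norm (x - u x) \<le> norm x / 2"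
    by metis
  have "p x \<le> (2 * M) * norm x" for x
  proof -
    \<comment> \<open>\<open>X k\<close> is the remainder after \<open>k\<close> approximation
      steps. The steps \<open>u (X k)\<close> telescope to \<open>x\<close>, and the norms of the
      remainders and the values of \<open>p\<close> at the steps are dominated by geometric
      sequences.\<close>
    define X where "X k = ((\<lambda>x. x - u x) ^^ k) x" for k
    have nX: "norm (X k) \<le> norm x * (1/2) ^ k" for k
    proof (induction k)
      case (Suc k)
      then show ?case using u(2)[of "X k"] by (simp add: X_def)
    qed (simp add: X_def)
    have sum: "(\<Sum>k<m. u (X k)) = x - X m" for m
      by (induction m) (simp_all add: X_def)
    have half: "(\<lambda>k. norm x * (1/2) ^ k) sums (norm x * 2)"
      using geometric_sums[of "1/2::real"] by (intro sums_mult) simp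
    have "X \<longlonglongrightarrow> 0"
      by (rule Lim_null_comparison[OF _ summable_LIMSEQ_zero[OF sums_summable[OF half]]])
        (simp add: nX)
    then have "(\<lambda>k. u (X k)) sums x"
      unfolding sums_def sum by (auto intro: tendsto_eq_intros)
    have bd: "p (u (X k)) \<le> M * (norm x * (1/2) ^ k)" for k
      by (rule order_trans[OF u(1) mult_left_mono[OF nX M]])
    have nonneg: "p y \<ge> 0" for y using add[of y "- y"] minus[of y] p0 by simp
    have smb: "summable (\<lambda>k. p (u (X k)))"
      by (rule summable_comparison_test'[OF summable_mult[OF sums_summable[OF half], of M], of 0])
        (simp add: bd nonneg)
    have "p x \<le> (\<Sum>k. p (u (X k)))" by (rule sub) fact+
    also have "\<dots> \<le> (\<Sum>k. M * (norm x * (1/2) ^ k))"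
      by (intro suminf_le bd smb summable_mult sums_summable[OF half])
    also have "\<dots> = 2 * M * norm x"
      using sums_mult[OF half, of M] by (simp add: sums_iff)
    finally show ?thesis .
  qed
  with that[of "2 * M"] M show ?thesis by simp
qed

text \<open>Zabreiko's lemma is applied to the norm of \<open>f x\<close>: if the norms of
  \<open>f (X n)\<close> have a finite sum, the series of the \<open>f (X n)\<close> converges, and
  closedness of the graph identifies its sum with \<open>f x\<close>.\<close>

lemma closed_graph:
  fixes f :: "'a::complex_banach \<Rightarrow> 'b::complex_banach"
  assumes lin: "clinear f"
    and cl: "\<And>X x y. X \<longlonglongrightarrow> x \<Longrightarrow> (\<lambda>n. f (X n)) \<longlonglongrightarrow> y \<Longrightarrow> f x = y"
  obtains K where "K \<ge> 0" "\<And>x. norm (f x) \<le> K * norm x"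
proof (rule countably_subadditive_imp_bounded[of "\<lambda>x. norm (f x)"])
  show "norm (f (r *\<^sub>R x)) \<le> \<bar>r\<bar> * norm (f x)" for r x
    by (simp add: clinear_scaleR[OF lin])
  have add: "f (x + y) = f x + f y" for x y using lin by (simp add: clinear_iff)
  have f0: "f 0 = 0" using add[of 0 0] by simp
  show "norm (f x) \<le> (\<Sum>n. norm (f (X n)))" if "X sums x" "summable (\<lambda>n. norm (f (X n)))" for X x
  proof -
    have "(\<lambda>n. f (\<Sum>k<n. X k)) = (\<lambda>n. \<Sum>k<n. f (X k))"
      by (rule ext) (induct_tac n, simp_all add: f0 add)
    with that have "f x = (\<Sum>n. f (X n))"
      by (intro cl[of "\<lambda>n. \<Sum>k<n. X k"])
        (auto simp: sums_def intro!: summable_LIMSEQ summable_norm_cancel)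
    with summable_norm[OF that(2)] show ?thesis by simp
  qed
qed (use that in blast)

text \<open>The inverse \<open>G\<close> of the canonical embedding into the bidual is bounded by
  the closed graph theorem. Evaluation at \<open>x\<close> is a bidual element \<open>J\<close> with
  \<open>G J = x\<close>, so a small norm of \<open>J\<close> would force a small norm of
  \<open>x\<close>.\<close>

lemma norming_dual_if_reflexive:
  assumes refl: "reflexive_space TYPE('a::complex_banach)"
    and separating: "\<And>x::'a. (\<And>f :: 'a \<Rightarrow>\<^sub>C\<^sub>L complex. cblinfun_apply f x = 0) \<Longrightarrow> x = 0"
  shows "norming_dual TYPE('a)"
proof -
  let ?a = cblinfun_apply
  have eqI: "x = y" if "\<And>f :: 'a \<Rightarrow>\<^sub>C\<^sub>L complex. ?a f x = ?a f y" for x y :: 'a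
    using separating[of "x - y"] that by (simp add: cblinfun_apply_diff_right)
  obtain G :: "(('a \<Rightarrow>\<^sub>C\<^sub>L complex) \<Rightarrow>\<^sub>C\<^sub>L complex) \<Rightarrow> 'a" where G: "\<And>F f. ?a F f = ?a f (G F)"
    using refl unfolding reflexive_space_def by metis
  have lin: "clinear G"
    unfolding clinear_iff
    by (auto intro!: eqI simp: G[symmetric] cblinfun_apply_add cblinfun_apply_scaleC
        cblinfun_apply_add_right cblinfun_apply_scaleC_right)
  have G_eqI: "G F = y" if "X \<longlonglongrightarrow> F" "(\<lambda>n. G (X n)) \<longlonglongrightarrow> y" for X F y
  proof (rule eqI)
    fix f
    have "bounded_linear (\<lambda>F :: ('a \<Rightarrow>\<^sub>C\<^sub>L complex) \<Rightarrow>\<^sub>C\<^sub>L complex. ?a F f)"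
      by (rule bounded_linear_if_clinear[where K = "norm f"])
        (use norm_cblinfun_apply_le in \<open>auto simp: clinear_iff cblinfun_apply_add cblinfun_apply_scaleC mult.commute\<close>)
    then have "(\<lambda>n. ?a (X n) f) \<longlonglongrightarrow> ?a F f" using that(1) by (rule bounded_linear.tendsto)
    moreover have "(\<lambda>n. ?a f (G (X n))) \<longlonglongrightarrow> ?a f y"
      using bounded_linear_cblinfun_apply that(2) by (rule bounded_linear.tendsto)
    ultimately show "?a f (G F) = ?a f y" using LIMSEQ_unique by (simp add: G) blast
  qed
  obtain K where K: "K \<ge> 0" "\<And>F. norm (G F) \<le> K * norm F"
  proof (rule closed_graph[OF lin])
    show "G F = y" if "X \<longlonglongrightarrow> F" "(\<lambda>n. G (X n)) \<longlonglongrightarrow> y" for X F y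
      using that by (rule G_eqI)
  qed (use that in blast)
  \<comment> \<open>\<open>K + 1\<close> in place of \<open>K\<close> keeps the denominator positive
    and makes the final inequality contradictory.\<close>
  have "\<exists>f. norm f \<le> 1 \<and> (1 / (K + 1)) * norm x \<le> cmod (?a f x)" for x :: 'a
  proof (rule ccontr)
    assume "\<not> ?thesis"
    then have less: "cmod (?a f x) < norm x / (K + 1)" if "norm f \<le> 1" for f :: "'a \<Rightarrow>\<^sub>C\<^sub>L complex"
      using that by (metis not_le mult_1 times_divide_eq_left)
    have x: "x \<noteq> 0" using less[of 0] by auto
    have bd: "cmod (?a f x) \<le> (norm x / (K + 1)) * norm f" for f :: "'a \<Rightarrow>\<^sub>C\<^sub>L complex"
    proof (cases "f = 0")
      case False
      then have "norm ((1 / norm f) *\<^sub>R f) \<le> 1" by simp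
      from less[OF this] False show ?thesis by (simp add: cblinfun_apply_scaleR field_simps)
    qed simp
    have lin: "clinear (\<lambda>f :: 'a \<Rightarrow>\<^sub>C\<^sub>L complex. ?a f x)"
      by (simp add: clinear_iff cblinfun_apply_add cblinfun_apply_scaleC)
    define J where "J = cblinfun_of (\<lambda>f :: 'a \<Rightarrow>\<^sub>C\<^sub>L complex. ?a f x)"
    have J: "?a J f = ?a f x" for f
      unfolding J_def by (subst cblinfun_of_apply_bound[OF lin bd]) simp
    have "G J = x" by (rule eqI) (simp add: G[symmetric] J)
    moreover have "norm J \<le> norm x / (K + 1)"
      by (rule norm_cblinfun_le) (use K bd J in auto)
    ultimately have "norm x \<le> K * (norm x / (K + 1))"
      using K(2)[of J] mult_left_mono[OF _ K(1)] by (metis order_trans)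
    then show False using x K(1) by (simp add: field_simps)
  qed
  then show ?thesis unfolding norming_dual_def using K(1) by (intro exI[of _ "1 / (K + 1)"]) auto
qed

section \<open>Unconditional convergence\<close>

text \<open>A bijection from \<open>F\<close> onto \<open>G\<close> is glued to one between the
  complements, which have equal cardinality because \<open>I\<close> is finite.\<close>

lemma bij_betw_swap_subset:
  assumes "finite I" "F \<subseteq> I" "G \<subseteq> I" "card F = card G"
  obtains h where "bij_betw h I I" "h ` F = G"
proof -
  have fin: "finite F" "finite G" using assms finite_subset by auto
  obtain h1 where h1: "bij_betw h1 F G" using finite_same_card_bij fin assms(4) by blast
  obtain h2 where h2: "bij_betw h2 (I - F) (I - G)"
    using finite_same_card_bij[of "I - F" "I - G"] assms fin by (auto simp: card_Diff_subset)
  define h where "h x = (if x \<in> F then h1 x else h2 x)" for x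
  have F: "bij_betw h F G" using h1 by (subst bij_betw_cong[of F h h1]) (auto simp: h_def)
  have "bij_betw h (I - F) (I - G)" using h2 by (subst bij_betw_cong[of _ h h2]) (auto simp: h_def)
  from bij_betw_combine[OF F this] have "bij_betw h I I"
    using assms by (simp add: Un_absorb1)
  with that F show ?thesis by (auto simp: bij_betw_def)
qed

lemma strict_mono_blocks:
  fixes t :: "nat \<Rightarrow> nat"
  assumes "strict_mono t" "t 0 = 0"
  obtains idx where "\<And>n. n \<in> {t (idx n)..<t (Suc (idx n))}" "\<And>n i. n \<in> {t i..<t (Suc i)} \<Longrightarrow> idx n = i"
proof -
  have ex: "\<exists>i. n \<in> {t i..<t (Suc i)}" for n
  proof -
    have "\<exists>i. n < t i" using strict_mono_imp_increasing[OF assms(1), of "Suc n"] by (auto simp: Suc_le_eq)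
    then have L: "n < t (LEAST i. n < t i)" by (rule LeastI_ex)
    \<comment> \<open>\<open>t 0 = 0\<close> rules out 0 as the least index, so it has a
      predecessor, which is the block number.\<close>
    obtain j where j: "(LEAST i. n < t i) = Suc j"
      using L assms(2) by (cases "LEAST i. n < t i") auto
    then have "\<not> n < t j" using not_less_Least[of j "\<lambda>i. n < t i"] by simp
    with L j show ?thesis by (intro exI[of _ j]) auto
  qed
  have uniq: "i = j" if "n \<in> {t i..<t (Suc i)}" "n \<in> {t j..<t (Suc j)}" for n i j
  proof -
    have "\<not> Suc i \<le> j" "\<not> Suc j \<le> i"
      using that strict_mono_less_eq[OF assms(1)] by (auto simp flip: not_less) (meson less_le_trans not_less)+
    then show ?thesis by auto
  qed
  from ex obtain idx where "\<And>n. n \<in> {t (idx n)..<t (Suc (idx n))}" by metis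
  with that uniq show ?thesis by blast
qed

lemma blockwise_bij:
  fixes t :: "nat \<Rightarrow> nat"
  assumes t: "strict_mono t" "t 0 = 0"
    and h: "\<And>i. bij_betw (h i) {t i..<t (Suc i)} {t i..<t (Suc i)}"
  obtains \<pi> where "bij \<pi>" "\<And>i n. n \<in> {t i..<t (Suc i)} \<Longrightarrow> \<pi> n = h i n"
proof -
  obtain idx where idx: "\<And>n. n \<in> {t (idx n)..<t (Suc (idx n))}"
    and idx_eq: "\<And>n i. n \<in> {t i..<t (Suc i)} \<Longrightarrow> idx n = i"
    using strict_mono_blocks[OF t] by blast
  define \<pi> where "\<pi> n = h (idx n) n" for n
  have mem: "\<pi> n \<in> {t (idx n)..<t (Suc (idx n))}" for n
    unfolding \<pi>_def using bij_betwE[OF h] idx by blast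
  have "inj \<pi>"
  proof
    fix m n assume eq: "\<pi> m = \<pi> n"
    then have "idx m = idx n" using idx_eq mem by metis
    then show "m = n"
      using eq idx[of m] idx[of n] bij_betw_imp_inj_on[OF h[of "idx n"]]
      by (simp add: \<pi>_def inj_on_def)
  qed
  moreover have "\<exists>m. n = \<pi> m" for n
  proof -
    obtain m where "m \<in> {t (idx n)..<t (Suc (idx n))}" "h (idx n) m = n"
      using bij_betw_imp_surj_on[OF h[of "idx n"]] idx[of n] by (metis imageE)
    then show ?thesis using idx_eq \<pi>_def by metis
  qed
  ultimately have "bij \<pi>" by (auto simp: bij_def surj_def)
  with that idx_eq show ?thesis by (simp add: \<pi>_def)
qed

text \<open>
  If a subseries violates the Cauchy criterion, moving its bad finite sections to the front of
  consecutive blocks gives a divergent rearrangement.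
\<close>

lemma summable_subseries:
  fixes x :: "nat \<Rightarrow> 'a::banach"
  assumes perm: "\<And>\<pi>. bij \<pi> \<Longrightarrow> summable (\<lambda>n. x (\<pi> n))"
  shows "summable (\<lambda>n. if n \<in> A then x n else 0)"
proof (rule ccontr)
  assume "\<not> ?thesis"
  then obtain e where e: "e > 0"
    and "\<forall>N. \<exists>m n. m \<ge> N \<and> e \<le> norm (\<Sum>k\<in>{m..<n}. if k \<in> A then x k else 0)"
    unfolding summable_Cauchy not_all not_ex not_imp not_less by blast
  then obtain l u where l: "\<And>N. l N \<ge> N"
    and u: "\<And>N. e \<le> norm (\<Sum>k\<in>{l N..<u N}. if k \<in> A then x k else 0)"
    by metis
  \<comment> \<open>Each block reaches at least to the end of the bad section found after its start;
    \<open>Suc N\<close> keeps it nonempty.\<close>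
  define t where "t i = rec_nat 0 (\<lambda>_ N. max (u N) (Suc N)) i" for i
  have t0: "t 0 = 0" and tS: "t (Suc i) = max (u (t i)) (Suc (t i))" for i
    by (simp_all add: t_def)
  have mono: "strict_mono t" by (auto simp: strict_mono_Suc_iff tS)
  define F where "F i = {l (t i)..<u (t i)} \<inter> A" for i
  have F: "F i \<subseteq> {t i..<t (Suc i)}" for i
    using l[of "t i"] by (auto simp: F_def tS)
  \<comment> \<open>\<open>G i\<close> is an initial segment of block \<open>i\<close> with as many
    elements as \<open>F i\<close>. Sending it onto \<open>F i\<close> makes the bad terms
    consecutive in the rearrangement.\<close>
  define G where "G i = {t i..<t i + card (F i)}" for i
  have cF: "card (F i) \<le> t (Suc i) - t i" for i
    using card_mono[OF _ F[of i]] by simp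
  have G: "G i \<subseteq> {t i..<t (Suc i)}" for i
    using cF[of i] strict_mono_less_eq[OF mono, of i "Suc i"] by (auto simp: G_def)
  have "\<exists>h. bij_betw h {t i..<t (Suc i)} {t i..<t (Suc i)} \<and> h ` G i = F i" for i
    by (rule bij_betw_swap_subset[OF _ G F]) (auto simp: G_def)
  then obtain h where h: "\<And>i. bij_betw (h i) {t i..<t (Suc i)} {t i..<t (Suc i)}"
    and hG: "\<And>i. h i ` G i = F i" by metis
  obtain \<pi> where \<pi>: "bij \<pi>" "\<And>i n. n \<in> {t i..<t (Suc i)} \<Longrightarrow> \<pi> n = h i n"
    using blockwise_bij[OF mono t0 h] by blast
  from perm[OF \<pi>(1)] e obtain N where N: "\<And>m n. m \<ge> N \<Longrightarrow> norm (\<Sum>k\<in>{m..<n}. x (\<pi> k)) < e"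
    unfolding summable_Cauchy by blast
  have img: "\<pi> ` G N = F N" using \<pi>(2) G[of N] hG[of N] by (metis image_cong subsetD)
  have "(\<Sum>k\<in>G N. x (\<pi> k)) = sum x (\<pi> ` G N)"
    using inj_on_subset[OF bij_is_inj[OF \<pi>(1)] subset_UNIV] by (simp add: sum.reindex)
  also have "\<dots> = (\<Sum>k\<in>{l (t N)..<u (t N)}. if k \<in> A then x k else 0)"
    unfolding img by (simp add: F_def sum.inter_restrict)
  finally have "e \<le> norm (\<Sum>k\<in>G N. x (\<pi> k))" using u by simp
  \<comment> \<open>Block \<open>N\<close> starts at \<open>t N\<close>, which is at least
    \<open>N\<close>, so the Cauchy estimate applies to it.\<close>
  moreover have "norm (\<Sum>k\<in>G N. x (\<pi> k)) < e"
    unfolding G_def by (rule N) (rule strict_mono_imp_increasing[OF mono])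
  ultimately show False by simp
qed

section \<open>An almost disjoint family\<close>

text \<open>
  The code of the first n digits of s, read as a binary number with leading digit 1. The ranges
  for different sequences share only the codes of common prefixes.
\<close>

fun prefix_code :: "(nat \<Rightarrow> bool) \<Rightarrow> nat \<Rightarrow> nat" where
  "prefix_code s 0 = 1"
| "prefix_code s (Suc n) = 2 * prefix_code s n + of_bool (s n)"

lemma strict_mono_prefix_code: "strict_mono (prefix_code s)"
proof -
  have "prefix_code s n > 0" for n by (induction n) auto
  then show ?thesis by (auto simp: strict_mono_Suc_iff)
qed

text \<open>Parity recovers the last digit, and halving the shorter code. A code of positive length
  is at least 2, so both recursions stop together at the code 1.\<close>

lemma prefix_code_eq: "prefix_code s m = prefix_code t n \<Longrightarrow> m = n \<and> (\<forall>i<n. s i = t i)"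
proof (induction m arbitrary: n)
  case 0
  have pos: "prefix_code t k > 0" for k by (induction k) auto
  show ?case
  proof (cases n)
    case (Suc k)
    with 0 pos[of k] show ?thesis by simp
  qed simp
next
  case (Suc m)
  have pos: "prefix_code t k > 0" "prefix_code s k > 0" for k by (induction k) auto
  show ?case
  proof (cases n)
    case 0
    with Suc.prems pos(2)[of m] show ?thesis by simp
  next
    case (Suc k)
    with Suc.prems have eq: "2 * prefix_code s m + of_bool (s m) = 2 * prefix_code t k + of_bool (t k)"
      by simp
    then have "prefix_code s m = prefix_code t k" "s m = t k"
      by (auto simp: of_bool_def split: if_splits) presburger+
    with Suc.IH[of k] Suc show ?thesis by (auto simp: less_Suc_eq)
  qed
qed

text \<open>A common code is the code of a common prefix, which cannot extend past a position where
  \<open>s\<close> and \<open>t\<close> differ.\<close>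

lemma finite_prefix_code_meet:
  assumes "s \<noteq> t"
  shows "finite {n. prefix_code s n \<in> range (prefix_code t)}"
proof -
  obtain i where "s i \<noteq> t i" using assms by auto
  then have "{n. prefix_code s n \<in> range (prefix_code t)} \<subseteq> {..i}"
    using prefix_code_eq[of s _ t] by (auto simp: not_less[symmetric] simp del: not_less) (metis (full_types))+
  then show ?thesis using finite_subset by blast
qed

section \<open>Subsymmetric bases\<close>

locale schauder =
  fixes b :: "nat \<Rightarrow> 'a::complex_banach"
  assumes basis: "schauder_basis b"
begin

section \<open>Coefficient functionals of a Schauder basis\<close>

definition coef :: "'a \<Rightarrow> nat \<Rightarrow> complex"
  where "coef x = (THE a. (\<lambda>n. a n *\<^sub>C b n) sums x)"

lemma coef_sums: "(\<lambda>n. coef x n *\<^sub>C b n) sums x"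
proof -
  have "\<exists>!a. (\<lambda>n. a n *\<^sub>C b n) sums x" using basis unfolding schauder_basis_def by blast
  then show ?thesis unfolding coef_def by (rule theI')
qed

lemma coef_eqI: "(\<lambda>n. a n *\<^sub>C b n) sums x \<Longrightarrow> coef x = a"
  using basis coef_sums unfolding schauder_basis_def by blast

lemma eq_if_coef_eq: "coef x = coef y \<Longrightarrow> x = y"
  using coef_sums sums_unique2 by metis

lemma coef_add: "coef (x + y) n = coef x n + coef y n"
  by (rule fun_cong, rule coef_eqI) (simp add: scaleC_add_left sums_add coef_sums)

lemma coef_scaleC: "coef (c *\<^sub>C x) n = c * coef x n"
  using bounded_linear.sums[OF bounded_linear_scaleC coef_sums, of c x]
  by (intro fun_cong[OF coef_eqI]) (simp add: scaleC_scaleC)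

text \<open>Otherwise 0 would have a second expansion. The bounds on coefficients divide by
  \<open>norm (b k)\<close>.\<close>

lemma basis_nonzero: "b k \<noteq> 0"
proof
  assume "b k = 0"
  then have "(\<lambda>n. of_bool (n = k) *\<^sub>C b n) = (\<lambda>n. 0)"
    by (auto simp: of_bool_def complex_vector.scale_zero_left)
  then have "coef 0 = (\<lambda>n. of_bool (n = k))" by (intro coef_eqI) simp
  moreover have "coef 0 = (\<lambda>_. 0)" by (intro coef_eqI) (simp add: complex_vector.scale_zero_left)
  ultimately show False using fun_cong[of "\<lambda>n. of_bool (n = k) :: complex" "\<lambda>_. 0" k] by simp
qed

text \<open>The supremum \<open>p\<close> of the norms of the partial sums is countably subadditive,
  hence bounded by Zabreiko's lemma. A coefficient is controlled by the difference of two
  consecutive partial sums.\<close>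

lemma coef_bounded:
  obtains K where "\<And>x. cmod (coef x k) \<le> K * norm x"
proof -
  define S where "S n x = (\<Sum>k<n. coef x k *\<^sub>C b k)" for n x
  have lim: "(\<lambda>n. S n x) \<longlonglongrightarrow> x" for x using coef_sums[of x] by (simp add: S_def sums_def)
  have bdd: "bdd_above (range (\<lambda>n. norm (S n x)))" for x
    using convergent_imp_Bseq[OF convergentI[OF lim[of x]]] by (auto simp: Bseq_def bdd_above_def)
  define p where "p x = (SUP n. norm (S n x))" for x
  have le_p: "norm (S n x) \<le> p x" for n x
    unfolding p_def by (rule cSUP_upper[OF _ bdd]) simp
  have diff: "coef x k *\<^sub>C b k = S (Suc k) x - S k x" for x k by (simp add: S_def)
  have le_2p: "cmod (coef x k) * norm (b k) \<le> 2 * p x" for x k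
    using norm_triangle_ineq4[of "S (Suc k) x" "S k x"] le_p[of "Suc k" x] le_p[of k x]
    by (simp add: diff flip: norm_scaleC)
  obtain K where K: "K \<ge> 0" "\<And>x. p x \<le> K * norm x"
  proof (rule countably_subadditive_imp_bounded[of p])
    fix r x
    have "S n (r *\<^sub>R x) = r *\<^sub>R S n x" for n
      by (simp add: S_def scaleR_scaleC coef_scaleC scaleC_scaleC complex_vector.scale_sum_right)
    then show "p (r *\<^sub>R x) \<le> \<bar>r\<bar> * p x"
      unfolding p_def[of "r *\<^sub>R x"] by (auto intro!: cSUP_least mult_left_mono le_p)
  next
    fix X x assume X: "X sums x" and sm: "summable (\<lambda>n. p (X n))"
    have sumS: "summable (\<lambda>n. S k (X n))" for k
      by (rule summable_comparison_test'[OF sm, of 0]) (simp add: le_p)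
    \<comment> \<open>\<open>T k\<close> is the candidate for the \<open>k\<close>-th partial sum of
      \<open>x\<close>. Convergence uniform in \<open>k\<close> permits the exchange of limits that
      gives \<open>T \<longlonglongrightarrow> x\<close>; uniqueness of the expansion then yields
      \<open>coef x = a\<close>.\<close>
    define T where "T k = (\<Sum>n. S k (X n))" for k
    have "uniform_limit UNIV (\<lambda>m k. \<Sum>n<m. S k (X n)) T sequentially"
      unfolding T_def by (rule Weierstrass_m_test[OF _ sm]) (simp add: le_p)
    then have T_lim: "T \<longlonglongrightarrow> x"
      by (rule swap_uniform_limit'[rotated 2, of _ _ _ _ sequentially "\<lambda>m. \<Sum>n<m. X n"])
        (use X in \<open>auto simp: sums_def intro!: always_eventually tendsto_sum lim\<close>)
    define a where "a k = (\<Sum>n. coef (X n) k)" for k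
    have suma: "summable (\<lambda>n. coef (X n) k)" for k
    proof (rule summable_comparison_test'[OF summable_mult[OF sm, of "2 / norm (b k)"], of 0])
      show "norm (coef (X n) k) \<le> 2 / norm (b k) * p (X n)" for n
        using le_2p[of "X n" k] basis_nonzero[of k] by (simp add: field_simps)
    qed
    have T_eq: "T n = (\<Sum>k<n. a k *\<^sub>C b k)" for n
    proof -
      have bl: "bounded_linear (\<lambda>c. c *\<^sub>C b k)" for k
        by (rule bounded_linear_if_clinear[where K = "norm (b k)"])
          (auto simp: clinear_iff scaleC_add_left scaleC_scaleC scaleC_complex_def norm_scaleC mult.commute)
      show ?thesis
        unfolding T_def S_def a_def bounded_linear.suminf[OF bl suma]
        by (rule suminf_sum) (rule bounded_linear.summable[OF bl suma])
    qed
    have "coef x = a"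
      by (rule coef_eqI) (use T_lim in \<open>simp add: sums_def flip: T_eq\<close>)
    then have Sx: "S n x = T n" for n by (simp add: S_def T_eq)
    show "p x \<le> (\<Sum>n. p (X n))"
      unfolding p_def[of x]
    proof (rule cSUP_least)
      fix n
      have "summable (\<lambda>i. norm (S n (X i)))"
        by (rule summable_comparison_test'[OF sm, of 0]) (simp add: le_p)
      then show "norm (S n x) \<le> (\<Sum>n. p (X n))"
        unfolding Sx T_def by (intro order_trans[OF summable_norm suminf_le]) (auto simp: le_p sm)
    qed simp
  qed blast
  have "cmod (coef x k) \<le> (2 * K / norm (b k)) * norm x" for x
    using le_2p[of x k] K(2)[of x] basis_nonzero[of k] by (simp add: field_simps)
  with that show ?thesis by blast
qed

definition coef_fun :: "nat \<Rightarrow> 'a \<Rightarrow>\<^sub>C\<^sub>L complex"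
  where "coef_fun k = cblinfun_of (\<lambda>x. coef x k)"

lemma coef_fun_apply: "cblinfun_apply (coef_fun k) x = coef x k"
proof -
  obtain K where "\<And>x. cmod (coef x k) \<le> K * norm x" using coef_bounded by blast
  then show ?thesis unfolding coef_fun_def
    by (subst cblinfun_of_apply_bound) (auto simp: clinear_iff coef_add coef_scaleC, simp add: scaleC_complex_def)
qed

lemma coef_tendsto: "X \<longlonglongrightarrow> x \<Longrightarrow> (\<lambda>n. coef (X n) k) \<longlonglongrightarrow> coef x k"
  using bounded_linear.tendsto[OF bounded_linear_cblinfun_apply[of "coef_fun k"]]
  by (simp add: coef_fun_apply)

text \<open>One form for both operators: spreading takes \<open>A = range \<sigma>\<close> and
  \<open>h = inv \<sigma>\<close>, collecting takes \<open>A = UNIV\<close> and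
  \<open>h = \<sigma>\<close>.\<close>

definition coef_map :: "nat set \<Rightarrow> (nat \<Rightarrow> nat) \<Rightarrow> 'a \<Rightarrow> nat \<Rightarrow> complex"
  where "coef_map A h x j = (if j \<in> A then coef x (h j) else 0)"

definition coef_op :: "nat set \<Rightarrow> (nat \<Rightarrow> nat) \<Rightarrow> 'a \<Rightarrow>\<^sub>C\<^sub>L 'a"
  where "coef_op A h = cblinfun_of (\<lambda>x. \<Sum>j. coef_map A h x j *\<^sub>C b j)"

text \<open>Boundedness comes from the closed graph theorem: coefficients are continuous, so a limit
  of images has the coefficients of the image of the limit.\<close>

lemma coef_coef_op:
  assumes "\<And>x. summable (\<lambda>j. coef_map A h x j *\<^sub>C b j)"
  shows "coef (cblinfun_apply (coef_op A h) x) = coef_map A h x"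
proof -
  define f where "f x = (\<Sum>j. coef_map A h x j *\<^sub>C b j)" for x
  have cf: "coef (f x) = coef_map A h x" for x
    unfolding f_def by (rule coef_eqI[OF summable_sums[OF assms]])
  have lin: "clinear f"
    unfolding clinear_iff
    by (intro conjI allI eq_if_coef_eq ext)
      (simp_all add: cf coef_add coef_scaleC coef_map_def)
  have cl: "f x = y" if "X \<longlonglongrightarrow> x" "(\<lambda>n. f (X n)) \<longlonglongrightarrow> y" for X x y
  proof (intro eq_if_coef_eq ext)
    fix j
    have "(\<lambda>n. coef_map A h (X n) j) \<longlonglongrightarrow> coef_map A h x j"
      by (simp add: coef_map_def coef_tendsto[OF that(1)])
    moreover have "(\<lambda>n. coef_map A h (X n) j) \<longlonglongrightarrow> coef y j"
      using coef_tendsto[OF that(2), of j] by (simp add: cf)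
    ultimately show "coef (f x) j = coef y j" using LIMSEQ_unique by (auto simp: cf)
  qed
  obtain K where "\<And>x. norm (f x) \<le> K * norm x"
  proof (rule closed_graph[OF lin])
    show "f x = y" if "X \<longlonglongrightarrow> x" "(\<lambda>n. f (X n)) \<longlonglongrightarrow> y" for X x y
      using that by (rule cl)
  qed (use that in blast)
  from cblinfun_of_apply_bound[OF lin this] show ?thesis
    by (simp add: coef_op_def cf flip: f_def)
qed

lemma separating:
  assumes "\<And>f :: 'a \<Rightarrow>\<^sub>C\<^sub>L complex. cblinfun_apply f x = 0"
  shows "x = 0"
  by (rule eq_if_coef_eq, rule ext) (simp add: assms flip: coef_fun_apply)

end

lemma subsymmetric_almost_orthogonal_copies:
  fixes b :: "nat \<Rightarrow> 'a::complex_banach"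
  assumes subsym: "subsymmetric_basis b"
  obtains U V :: "(nat \<Rightarrow> bool) \<Rightarrow> ('a \<Rightarrow>\<^sub>C\<^sub>L 'a)" where "almost_orthogonal_copies U V"
proof -
  interpret schauder b
    using subsym by unfold_locales (auto simp: subsymmetric_basis_def unconditional_basis_def)
  let ?a = cblinfun_apply
  define \<sigma> where "\<sigma> = prefix_code"
  have mono: "strict_mono (\<sigma> s)" for s by (simp add: \<sigma>_def strict_mono_prefix_code)
  have inj: "inj (\<sigma> s)" for s by (rule strict_mono_imp_inj_on[OF mono])
  have equiv: "summable (\<lambda>n. a n *\<^sub>C b (\<sigma> s n)) \<longleftrightarrow> summable (\<lambda>n. a n *\<^sub>C b n)" for s and a :: "nat \<Rightarrow> complex"
    using subsym mono by (simp add: subsymmetric_basis_def equivalent_seqs_def)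
  have uncond: "summable (\<lambda>n. a (\<pi> n) *\<^sub>C b (\<pi> n))"
    if "summable (\<lambda>n. a n *\<^sub>C b n)" "bij \<pi>" for \<pi> and a :: "nat \<Rightarrow> complex"
    using subsym that by (simp add: subsymmetric_basis_def unconditional_basis_def)
  have smb: "summable (\<lambda>n. coef x n *\<^sub>C b n)" for x by (rule sums_summable[OF coef_sums])
  define U where "U s = coef_op (range (\<sigma> s)) (inv (\<sigma> s))" for s
  define V where "V s = coef_op UNIV (\<sigma> s)" for s
  have U: "coef (?a (U s) x) = coef_map (range (\<sigma> s)) (inv (\<sigma> s)) x" for s x
    unfolding U_def
  proof (rule coef_coef_op)
    fix x
    \<comment> \<open>Reindexed along \<open>\<sigma> s\<close>, the series carries the coefficients
      of \<open>x\<close> on a subsequence of the basis; equivalence with the whole basis gives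
      convergence.\<close>
    show "summable (\<lambda>j. coef_map (range (\<sigma> s)) (inv (\<sigma> s)) x j *\<^sub>C b j)"
      by (subst summable_mono_reindex[OF mono[of s], symmetric])
        (use smb[of x] in \<open>simp_all add: coef_map_def complex_vector.scale_zero_left inv_f_f[OF inj] equiv\<close>)
  qed
  have V: "coef (?a (V s) x) = coef_map UNIV (\<sigma> s) x" for s x
    unfolding V_def
  proof (rule coef_coef_op)
    fix x
    let ?y = "\<lambda>n. if n \<in> range (\<sigma> s) then coef x n *\<^sub>C b n else 0"
    \<comment> \<open>Unconditionality permits restricting the series to the range of
      \<open>\<sigma> s\<close>; equivalence then moves the coefficients from
      \<open>b (\<sigma> s n)\<close> to \<open>b n\<close>.\<close>
    have "summable ?y" by (rule summable_subseries) (rule uncond[OF smb])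
    then have "summable (\<lambda>n. ?y (\<sigma> s n))"
      by (subst summable_mono_reindex[OF mono]) auto
    then show "summable (\<lambda>j. coef_map UNIV (\<sigma> s) x j *\<^sub>C b j)"
      by (simp add: coef_map_def equiv)
  qed
  have "?a (V s) (?a (U s) x) = x" for s x
    by (intro eq_if_coef_eq ext) (simp add: V U coef_map_def inv_f_f[OF inj])
  moreover have "V s o\<^sub>C\<^sub>L U t \<in> finite_rank_ops" if "s \<noteq> t" for s t
  proof -
    \<comment> \<open>\<open>K\<close> holds the positions at which \<open>V s\<close> reads a
      coordinate written by \<open>U t\<close>; all other coefficients of the image vanish.\<close>
    define K where "K = {j. \<sigma> s j \<in> range (\<sigma> t)}"
    have K: "finite K" using finite_prefix_code_meet[OF that] by (simp add: K_def \<sigma>_def)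
    have "V s o\<^sub>C\<^sub>L U t = (\<Sum>j\<in>K. rank_one_op (b j) (coef_fun (inv (\<sigma> t) (\<sigma> s j))))" (is "?L = ?R")
    proof (rule cblinfun_eqI)
      fix x
      have sum_apply: "?a (\<Sum>j\<in>I. F j) x = (\<Sum>j\<in>I. ?a (F j) x)" for I :: "nat set" and F :: "nat \<Rightarrow> 'a \<Rightarrow>\<^sub>C\<^sub>L 'a"
        by (induction I rule: infinite_finite_induct) (auto simp: cblinfun_apply_add)
      have "(\<lambda>j. coef (?a (V s) (?a (U t) x)) j *\<^sub>C b j) sums (\<Sum>j\<in>K. coef (?a (V s) (?a (U t) x)) j *\<^sub>C b j)"
        by (rule sums_finite[OF K]) (simp add: V U coef_map_def K_def complex_vector.scale_zero_left)
      then have "?a ?L x = (\<Sum>j\<in>K. coef (?a (V s) (?a (U t) x)) j *\<^sub>C b j)"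
        using coef_sums sums_unique2 by (metis cblinfun_apply_compose)
      also have "\<dots> = ?a ?R x"
        by (simp add: sum_apply rank_one_op_apply coef_fun_apply V U coef_map_def K_def)
      finally show "?a ?L x = ?a ?R x" .
    qed
    also have "\<dots> \<in> finite_rank_ops" unfolding finite_rank_ops_def
      by (rule complex_vector.span_sum, rule complex_vector.span_base) blast
    finally show ?thesis .
  qed
  ultimately show ?thesis using that[of U V] by (simp add: almost_orthogonal_copies_def)
qed

lemma norming_dual_if_reflexive_basis:
  assumes "reflexive_space TYPE('a::complex_banach)" "subsymmetric_basis (b :: nat \<Rightarrow> 'a)"
  shows "norming_dual TYPE('a)"
proof -
  interpret schauder b
    using assms(2) by unfold_locales (auto simp: subsymmetric_basis_def unconditional_basis_def)
  show ?thesis by (rule norming_dual_if_reflexive[OF assms(1) separating])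
qed

section \<open>The coin tossing space\<close>

definition fair_coin :: "bool measure"
  where "fair_coin = uniform_count_measure UNIV"

definition coins :: "(nat \<Rightarrow> bool) measure"
  where "coins = PiM UNIV (\<lambda>_. fair_coin)"

lemma sets_fair_coin [measurable_cong, simp]: "sets fair_coin = sets (count_space UNIV)"
  and space_fair_coin [simp]: "space fair_coin = UNIV"
  by (simp_all add: fair_coin_def sets_uniform_count_measure_count_space space_uniform_count_measure)

lemma measurable_fair_coin: "measurable M fair_coin = measurable M (count_space UNIV)"
  by (rule measurable_cong_sets) simp_all

lemma emeasure_fair_coin: "emeasure fair_coin A = of_nat (card A) * ennreal (1 / 2)"
proof -
  have "emeasure fair_coin A = ennreal (real (card A) * (1 / 2))"
    by (simp add: fair_coin_def emeasure_uniform_count_measure)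
  also have "\<dots> = of_nat (card A) * ennreal (1 / 2)"
    by (subst ennreal_mult) (auto simp: ennreal_of_nat_eq_real_of_nat)
  finally show ?thesis .
qed

interpretation fair_coin: prob_space fair_coin
  unfolding fair_coin_def by (rule prob_space_uniform_count_measure) auto

interpretation coins: prob_space coins
  unfolding coins_def by (intro prob_space_PiM fair_coin.prob_space_axioms)

interpretation coins_pair: pair_prob_space coins coins ..

lemma space_coins [simp]: "space coins = UNIV"
  by (simp add: coins_def space_PiM)

lemma measurable_coins_component [measurable]: "(\<lambda>\<omega>. \<omega> n) \<in> measurable coins (count_space UNIV)"
proof -
  have "(\<lambda>\<omega>. \<omega> n) \<in> measurable coins fair_coin"
    unfolding coins_def by (rule measurable_component_singleton) simp
  then show ?thesis by (simp only: measurable_fair_coin)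
qed

lemma measurable_coinsI:
  assumes "\<And>n. (\<lambda>x. f x n) \<in> measurable M (count_space UNIV)"
  shows "f \<in> measurable M coins"
  unfolding coins_def
  using measurable_PiM_single'[of UNIV "\<lambda>n x. f x n" M "\<lambda>_. fair_coin"] assms
  by (simp add: measurable_fair_coin PiE_UNIV_domain)

lemma prod_emb_coins:
  "prod_emb UNIV (\<lambda>_. fair_coin) J (Pi\<^sub>E J A) = {\<omega>. \<forall>i\<in>J. \<omega> i \<in> A i}"
  by (auto simp: prod_emb_def PiE_iff)

lemma emeasure_coins_cylinder:
  assumes "finite J"
  shows "emeasure coins {\<omega>. \<forall>i\<in>J. \<omega> i \<in> A i} = (\<Prod>i\<in>J. emeasure fair_coin (A i))"
  using emeasure_PiM_emb[of UNIV "\<lambda>_. fair_coin" J A] assms fair_coin.prob_space_axioms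
  by (simp add: coins_def prod_emb_coins)

lemma sets_coins_cylinder [measurable]:
  assumes "finite J"
  shows "{\<omega>. \<forall>i\<in>J. \<omega> i \<in> A i} \<in> sets coins"
proof -
  have "{\<omega> \<in> space coins. \<forall>i\<in>J. \<omega> i \<in> A i} \<in> sets coins"
    using assms by (intro sets.sets_Collect_finite_All) (use measurable_sets[OF measurable_coins_component] in \<open>auto simp: vimage_def\<close>)
  then show ?thesis by simp
qed

text \<open>Cylinders are stable under intersection and generate the product sigma-algebra.\<close>

lemma coins_eqI:
  assumes "sets N = sets coins"
    and "\<And>J A. finite J \<Longrightarrow> emeasure N {\<omega>. \<forall>i\<in>J. \<omega> i \<in> A i} = (\<Prod>i\<in>J. emeasure fair_coin (A i))"
  shows "N = coins"
  unfolding coins_def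
proof (rule measure_eqI_PiM_infinite[symmetric, OF refl])
  show "finite_measure (PiM (UNIV :: nat set) (\<lambda>_. fair_coin))"
    using coins.finite_measure_axioms by (simp add: coins_def)
  show "sets N = sets (PiM UNIV (\<lambda>_. fair_coin))" using assms(1) by (simp add: coins_def)
  fix A :: "nat \<Rightarrow> bool set" and J :: "nat set" assume "finite J"
  then show "emeasure (PiM UNIV (\<lambda>_. fair_coin)) (prod_emb UNIV (\<lambda>_. fair_coin) J (Pi\<^sub>E J A)) =
      emeasure N (prod_emb UNIV (\<lambda>_. fair_coin) J (Pi\<^sub>E J A))"
    using emeasure_coins_cylinder[of J A] assms(2)[of J A] by (simp add: prod_emb_coins coins_def)
qed

section \<open>Selecting and merging coordinates\<close>

definition select :: "(nat \<Rightarrow> nat) \<Rightarrow> (nat \<Rightarrow> bool) \<Rightarrow> nat \<Rightarrow> bool"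
  where "select \<sigma> \<omega> = (\<lambda>n. \<omega> (\<sigma> n))"

definition interleave :: "(nat \<Rightarrow> nat) \<Rightarrow> (nat \<Rightarrow> bool) \<times> (nat \<Rightarrow> bool) \<Rightarrow> nat \<Rightarrow> bool"
  where "interleave \<sigma> = (\<lambda>(\<omega>, \<omega>') n. if n \<in> range \<sigma> then \<omega> (inv \<sigma> n) else \<omega>' n)"

lemma select_interleave: "inj \<sigma> \<Longrightarrow> select \<sigma> (interleave \<sigma> (\<omega>, \<omega>')) = \<omega>"
  by (simp add: select_def interleave_def)

lemma measurable_select [measurable]: "select \<sigma> \<in> measurable coins coins"
  unfolding select_def by (rule measurable_coinsI) measurable

lemma measurable_interleave [measurable]: "interleave \<sigma> \<in> measurable (coins \<Otimes>\<^sub>M coins) coins"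
proof (rule measurable_coinsI)
  fix n
  show "(\<lambda>x. interleave \<sigma> x n) \<in> measurable (coins \<Otimes>\<^sub>M coins) (count_space UNIV)"
    by (cases "n \<in> range \<sigma>") (simp_all add: interleave_def case_prod_beta)
qed

text \<open>The preimage of a cylinder is a product of two cylinders: the coordinates of
  \<open>J\<close> in the range of \<open>\<sigma>\<close>, pulled back, constrain the first factor,
  and the remaining ones the second.\<close>

lemma distr_interleave:
  assumes "inj \<sigma>"
  shows "distr (coins \<Otimes>\<^sub>M coins) coins (interleave \<sigma>) = coins"
proof (rule coins_eqI)
  fix J :: "nat set" and A :: "nat \<Rightarrow> bool set" assume J: "finite J"
  let ?m = "emeasure fair_coin"
  let ?K = "\<sigma> -` J" and ?L = "J - range \<sigma>"
  have K: "finite ?K" using finite_vimageI[OF J assms] .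
  have "interleave \<sigma> -` {\<omega>. \<forall>i\<in>J. \<omega> i \<in> A i} =
      {\<omega>. \<forall>i\<in>?K. \<omega> i \<in> A (\<sigma> i)} \<times> {\<omega>. \<forall>i\<in>?L. \<omega> i \<in> A i}"
  proof (intro equalityI subsetI)
    fix x assume "x \<in> interleave \<sigma> -` {\<omega>. \<forall>i\<in>J. \<omega> i \<in> A i}"
    then have *: "interleave \<sigma> x i \<in> A i" if "i \<in> J" for i using that by auto
    have "fst x i \<in> A (\<sigma> i)" if "\<sigma> i \<in> J" for i
      using *[OF that] assms by (simp add: interleave_def case_prod_beta)
    moreover have "snd x i \<in> A i" if "i \<in> J - range \<sigma>" for i
      using *[of i] that by (simp add: interleave_def case_prod_beta)
    ultimately show "x \<in> {\<omega>. \<forall>i\<in>?K. \<omega> i \<in> A (\<sigma> i)} \<times> {\<omega>. \<forall>i\<in>?L. \<omega> i \<in> A i}"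
      by (auto simp: mem_Times_iff)
  next
    fix x assume x: "x \<in> {\<omega>. \<forall>i\<in>?K. \<omega> i \<in> A (\<sigma> i)} \<times> {\<omega>. \<forall>i\<in>?L. \<omega> i \<in> A i}"
    have "interleave \<sigma> x i \<in> A i" if "i \<in> J" for i
      using x that assms by (cases "i \<in> range \<sigma>") (auto simp: interleave_def case_prod_beta)
    then show "x \<in> interleave \<sigma> -` {\<omega>. \<forall>i\<in>J. \<omega> i \<in> A i}" by auto
  qed
  then have "emeasure (distr (coins \<Otimes>\<^sub>M coins) coins (interleave \<sigma>)) {\<omega>. \<forall>i\<in>J. \<omega> i \<in> A i} =
      emeasure coins {\<omega>. \<forall>i\<in>?K. \<omega> i \<in> A (\<sigma> i)} * emeasure coins {\<omega>. \<forall>i\<in>?L. \<omega> i \<in> A i}"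
    using J K by (simp add: emeasure_distr space_pair_measure coins.emeasure_pair_measure_Times)
  also have "\<dots> = (\<Prod>i\<in>?K. ?m (A (\<sigma> i))) * (\<Prod>i\<in>?L. ?m (A i))"
    using J K by (simp add: emeasure_coins_cylinder)
  also have "(\<Prod>i\<in>?K. ?m (A (\<sigma> i))) = (\<Prod>i\<in>\<sigma> ` ?K. ?m (A i))"
    by (simp only: prod.reindex[OF inj_on_subset[OF assms subset_UNIV]] o_def)
  also have "\<dots> * (\<Prod>i\<in>?L. ?m (A i)) = (\<Prod>i\<in>\<sigma> ` ?K \<union> ?L. ?m (A i))"
    using J K by (intro prod.union_disjoint[symmetric]) auto
  also have "\<sigma> ` ?K \<union> ?L = J" by auto
  finally show "emeasure (distr (coins \<Otimes>\<^sub>M coins) coins (interleave \<sigma>)) {\<omega>. \<forall>i\<in>J. \<omega> i \<in> A i} = (\<Prod>i\<in>J. ?m (A i))" .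
qed simp

lemma distr_select:
  assumes "inj \<sigma>"
  shows "distr coins coins (select \<sigma>) = coins"
  using distr_PiM_reindex[of UNIV "\<lambda>_. fair_coin" \<sigma> UNIV] assms fair_coin.prob_space_axioms
  by (simp add: coins_def select_def[abs_def] restrict_UNIV)

section \<open>Binary digits\<close>

abbreviation unit_interval :: "real measure"
  where "unit_interval \<equiv> lebesgue_on {0..1}"

text \<open>Index 0 is the first digit after the binary point. At dyadic rationals the floor picks
  the terminating expansion.\<close>

definition digit :: "real \<Rightarrow> nat \<Rightarrow> bool"
  where "digit t n = odd \<lfloor>2 ^ Suc n * t\<rfloor>"

text \<open>Halving \<open>t + of_bool b\<close> prepends the digit \<open>b\<close>: the floors
  that give the later digits change by an even integer.\<close>

lemma digit_Suc: "digit ((t + of_bool b) / 2) (Suc n) = digit t n"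
proof -
  have "2 ^ Suc (Suc n) * ((t + of_bool b) / 2) = 2 ^ Suc n * t + of_int (2 ^ Suc n * of_bool b)"
    by (simp add: field_simps)
  then have "\<lfloor>2 ^ Suc (Suc n) * ((t + of_bool b) / 2)\<rfloor> = \<lfloor>2 ^ Suc n * t\<rfloor> + 2 ^ Suc n * of_bool b"
    by (simp only: floor_add_int)
  then show ?thesis unfolding digit_def by (metis even_add even_mult_iff even_numeral even_power zero_less_Suc)
qed

lemma digit_0: "t \<in> {0..<1} \<Longrightarrow> digit ((t + of_bool b) / 2) 0 = b"
proof -
  assume "t \<in> {0..<1}"
  then have "\<lfloor>2 ^ Suc 0 * ((t + of_bool b) / 2)\<rfloor> = of_bool b"
    by (intro floor_unique) auto
  then show ?thesis by (simp add: digit_def)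
qed

lemma measurable_digit: "digit \<in> measurable borel coins"
  unfolding digit_def by (rule measurable_coinsI) measurable

lemma measurable_digit_unit_interval [measurable]: "digit \<in> measurable unit_interval coins"
  by (intro measurable_restrict_space1 measurable_completion) (use measurable_digit in simp)

text \<open>Induction by prepending a digit: the set for \<open>Suc n\<close> digits is a disjoint
  union, over \<open>b\<close> in \<open>A 0\<close>, of images of a set for \<open>n\<close> digits
  under maps that halve the measure.\<close>

lemma emeasure_digit_prefix:
  "{t\<in>{0..<1}. \<forall>i<n. digit t i \<in> A i} \<in> sets borel \<and>
   emeasure lebesgue {t\<in>{0..<1}. \<forall>i<n. digit t i \<in> A i} = (\<Prod>i<n. emeasure fair_coin (A i))"
proof (induction n arbitrary: A)
  case 0
  have "{t::real. 0 \<le> t \<and> t < 1} = {0..<1}" by auto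
  then show ?case by simp
next
  case (Suc n)
  let ?S = "{t\<in>{0..<1}. \<forall>i<n. digit t i \<in> A (Suc i)}"
  let ?T = "{t\<in>{0..<1}. \<forall>i<Suc n. digit t i \<in> A i}"
  let ?g = "\<lambda>b t. (1/2) *\<^sub>R t + of_bool b / 2 :: real"
  have g: "?g b t = (t + of_bool b) / 2" for b t by simp
  have meas: "{t\<in>{0..<1}. \<forall>i<m. digit t i \<in> B i} \<in> sets borel" for m and B :: "nat \<Rightarrow> bool set"
  proof -
    have "{t. \<forall>i\<in>{..<m}. digit t i \<in> B i} \<in> sets borel"
      using measurable_sets[OF measurable_digit sets_coins_cylinder[of "{..<m}" B]] by (simp add: vimage_def)
    then have "{0..<1} \<inter> {t. \<forall>i\<in>{..<m}. digit t i \<in> B i} \<in> sets borel" by (intro sets.Int) auto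
    also have "{0..<1} \<inter> {t. \<forall>i\<in>{..<m}. digit t i \<in> B i} = {t\<in>{0..<1}. \<forall>i<m. digit t i \<in> B i}" by auto
    finally show ?thesis .
  qed
  have all_Suc: "(\<forall>i<Suc n. P i) \<longleftrightarrow> P 0 \<and> (\<forall>i<n. P (Suc i))" for P
    by (auto simp: less_Suc_eq_0_disj)
  have T: "?T = (\<Union>b\<in>A 0. ?g b ` ?S)"
  proof (intro equalityI subsetI)
    fix t assume t: "t \<in> ?T"
    define b where "b = digit t 0"
    define s where "s = 2 * t - of_bool b"
    have ts: "t = (s + of_bool b) / 2" by (simp add: s_def)
    have "s \<in> {0..<1}"
    proof (cases "t < 1/2")
      case True
      then have "\<lfloor>2 * t\<rfloor> = 0" using t by (intro floor_unique) auto
      then show ?thesis using True t by (simp add: s_def b_def digit_def)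
    next
      case False
      then have "\<lfloor>2 * t\<rfloor> = 1" using t by (intro floor_unique) auto
      then show ?thesis using False t by (simp add: s_def b_def digit_def)
    qed
    moreover have "digit s i = digit t (Suc i)" for i
      unfolding ts by (rule digit_Suc[symmetric])
    ultimately have "s \<in> ?S" using t by (auto simp: all_Suc)
    moreover have "b \<in> A 0" using t by (auto simp: b_def)
    ultimately show "t \<in> (\<Union>b\<in>A 0. ?g b ` ?S)" using ts g by (auto intro!: bexI[of _ b] image_eqI[of _ _ s])
  next
    fix t assume "t \<in> (\<Union>b\<in>A 0. ?g b ` ?S)"
    then obtain b s where bs: "b \<in> A 0" "s \<in> ?S" "t = (s + of_bool b) / 2" by auto
    then have "t \<in> {0..<1}" by (cases b) auto
    moreover have "digit t 0 = b" unfolding bs(3) using bs(2) by (intro digit_0) auto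
    moreover have "digit t (Suc i) = digit s i" for i unfolding bs(3) by (rule digit_Suc)
    ultimately show "t \<in> ?T" using bs(1,2) by (auto simp: all_Suc)
  qed
  have img: "?g b ` ?S \<in> sets lebesgue" for b
  proof -
    \<comment> \<open>Measurability of the image is read off the preimage under the inverse affine
      map.\<close>
    have "?g b ` ?S = (\<lambda>t. 2 * t - of_bool b) -` ?S"
    proof (intro equalityI subsetI)
      fix t assume "t \<in> (\<lambda>t. 2 * t - of_bool b) -` ?S"
      then have "2 * t - of_bool b \<in> ?S" by (rule vimageD)
      moreover have "t = ?g b (2 * t - of_bool b)" by (simp add: field_simps)
      ultimately show "t \<in> ?g b ` ?S" by (rule rev_image_eqI)
    qed auto
    also have "\<dots> \<in> sets borel" by (rule measurable_sets_borel[OF _ meas]) measurable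
    finally show ?thesis by auto
  qed
  have em: "emeasure lebesgue (?g b ` S) = ennreal (1/2) * emeasure lebesgue S" for b S
    using emeasure_lebesgue_affine[of "1/2" "of_bool b / 2 :: real" S] by simp
  have disj: "disjoint_family_on (\<lambda>b. ?g b ` ?S) (A 0)"
    unfolding disjoint_family_on_def
  proof (intro ballI impI equals0I)
    fix b c t assume "b \<noteq> c" "t \<in> ?g b ` ?S \<inter> ?g c ` ?S"
    then obtain s s' where "s \<in> {0..<1}" "t = (s + of_bool b) / 2" "s' \<in> {0..<1}" "t = (s' + of_bool c) / 2"
      unfolding g by blast
    then have "digit t 0 = b" "digit t 0 = c" using digit_0 by metis+
    with \<open>b \<noteq> c\<close> show False by simp
  qed
  have "emeasure lebesgue ?T = (\<Sum>b\<in>A 0. emeasure lebesgue (?g b ` ?S))"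
    unfolding T by (rule sum_emeasure[symmetric]) (use img disj in auto)
  also have "\<dots> = emeasure fair_coin (A 0) * emeasure lebesgue ?S"
    by (simp only: em sum_constant emeasure_fair_coin mult.assoc)
  also have "\<dots> = (\<Prod>i<Suc n. emeasure fair_coin (A i))"
    using Suc.IH[of "\<lambda>i. A (Suc i)"] by (simp only: prod.lessThan_Suc_shift)
  finally show ?case using meas by blast
qed

lemma emeasure_distr_digit:
  assumes "X \<in> sets coins"
  shows "digit -` X \<inter> {0..1} \<in> sets lebesgue"
    and "emeasure (distr unit_interval coins digit) X = emeasure lebesgue (digit -` X \<inter> {0..1})"
proof -
  have "digit -` X \<inter> {0..1} \<in> sets unit_interval"
    using measurable_sets[OF measurable_digit_unit_interval assms] by simp
  then show "digit -` X \<inter> {0..1} \<in> sets lebesgue" by (simp add: sets_restrict_space_iff)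
  show "emeasure (distr unit_interval coins digit) X = emeasure lebesgue (digit -` X \<inter> {0..1})"
    using assms by (simp add: emeasure_distr emeasure_restrict_space)
qed

lemma distr_digit: "distr unit_interval coins digit = coins"
proof (rule coins_eqI)
  fix J :: "nat set" and A :: "nat \<Rightarrow> bool set" assume J: "finite J"
  \<comment> \<open>The constraints on \<open>J\<close> are padded by \<open>UNIV\<close>, of
    measure 1, to an initial segment of coordinates.\<close>
  obtain n where n: "J \<subseteq> {..<n}" using J finite_nat_iff_bounded by blast
  define B where "B i = (if i \<in> J then A i else UNIV)" for i
  have eq: "{\<omega>. \<forall>i\<in>J. \<omega> i \<in> A i} = {\<omega>. \<forall>i<n. \<omega> i \<in> B i}" using n by (auto simp: B_def)
  have m: "{\<omega>. \<forall>i<n. \<omega> i \<in> B i} \<in> sets coins" using sets_coins_cylinder[OF J, of A] by (simp only: eq)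
  let ?D = "digit -` {\<omega>. \<forall>i<n. \<omega> i \<in> B i} \<inter> {0..1}"
  have D: "?D \<in> sets lebesgue"
    by (rule emeasure_distr_digit(1)[OF m])
  have "emeasure (distr unit_interval coins digit) {\<omega>. \<forall>i<n. \<omega> i \<in> B i} = emeasure lebesgue ?D"
    by (rule emeasure_distr_digit(2)[OF m])
  \<comment> \<open>The closed interval and the half-open one differ only in the point 1.\<close>
  also have "\<dots> = emeasure lebesgue {t\<in>{0..<1}. \<forall>i<n. digit t i \<in> B i}"
  proof (rule emeasure_eq_AE)
    have "AE t in lebesgue. t \<noteq> (1::real)" by (rule AE_completion) (rule AE_lborel_singleton)
    then show "AE t in lebesgue. t \<in> ?D \<longleftrightarrow> t \<in> {t\<in>{0..<1}. \<forall>i<n. digit t i \<in> B i}"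
      by eventually_elim auto
  next
    show "{t\<in>{0..<1}. \<forall>i<n. digit t i \<in> B i} \<in> sets lebesgue"
      by (rule sets_completionI_sets) (use emeasure_digit_prefix[of n B] in \<open>simp only: sets_lborel\<close>)
  qed (rule D)
  also have "\<dots> = (\<Prod>i<n. emeasure fair_coin (B i))" using emeasure_digit_prefix by blast
  also have "\<dots> = (\<Prod>i\<in>J. emeasure fair_coin (A i))"
    using n fair_coin.emeasure_space_1 by (intro prod.mono_neutral_cong_right) (auto simp: B_def)
  finally show "emeasure (distr unit_interval coins digit) {\<omega>. \<forall>i\<in>J. \<omega> i \<in> A i} = (\<Prod>i\<in>J. emeasure fair_coin (A i))"
    by (simp only: eq)
qed simp

section \<open>Recovering a number from its binary digits\<close>

definition binary_value :: "(nat \<Rightarrow> bool) \<Rightarrow> real"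
  where "binary_value \<omega> = (\<Sum>n. of_bool (\<omega> n) * (1/2) ^ Suc n)"

lemma measurable_binary_value [measurable]: "binary_value \<in> borel_measurable coins"
  unfolding binary_value_def by measurable

lemma binary_value_digit:
  assumes "t \<in> {0..<1}"
  shows "binary_value (digit t) = t"
proof -
  \<comment> \<open>The partial sums truncate \<open>t\<close> to \<open>n\<close> digits; passing
    to \<open>Suc n\<close> doubles the floor and adds the next digit.\<close>
  have part: "(\<Sum>k<n. of_bool (digit t k) * (1/2) ^ Suc k) = real_of_int \<lfloor>2 ^ n * t\<rfloor> / 2 ^ n" for n
  proof (induction n)
    case 0
    then show ?case using assms floor_unique[of 0 t] by simp
  next
    case (Suc n)
    have "\<lfloor>2 ^ Suc n * t\<rfloor> = 2 * \<lfloor>2 ^ n * t\<rfloor> + of_bool (digit t n)"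
    proof -
      have "\<lfloor>2 ^ Suc n * t\<rfloor> div 2 = \<lfloor>2 ^ n * t\<rfloor>"
        using floor_divide_real_eq_div[of 2 "2 ^ Suc n * t"] by simp
      then show ?thesis using div_mult_mod_eq[of "\<lfloor>2 ^ Suc n * t\<rfloor>" 2]
        by (simp add: digit_def mod_2_eq_odd)
    qed
    then show ?case using Suc.IH by (simp add: field_simps)
  qed
  have "(\<lambda>n. real_of_int \<lfloor>2 ^ n * t\<rfloor> / 2 ^ n) \<longlonglongrightarrow> t"
  proof (rule real_tendsto_sandwich)
    show "\<forall>\<^sub>F n in sequentially. t - (1/2) ^ n \<le> real_of_int \<lfloor>2 ^ n * t\<rfloor> / 2 ^ n"
    proof (rule always_eventually, rule allI)
      fix n
      have "(2 ^ n * t - 1) / 2 ^ n \<le> real_of_int \<lfloor>2 ^ n * t\<rfloor> / 2 ^ n"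
        by (rule divide_right_mono) (linarith, simp)
      then show "t - (1/2) ^ n \<le> real_of_int \<lfloor>2 ^ n * t\<rfloor> / 2 ^ n"
        by (simp add: diff_divide_distrib power_one_over)
    qed
    show "\<forall>\<^sub>F n in sequentially. real_of_int \<lfloor>2 ^ n * t\<rfloor> / 2 ^ n \<le> t"
      by (rule always_eventually) (auto simp: field_simps)
    have "(\<lambda>n. (1/2::real) ^ n) \<longlonglongrightarrow> 0" by (rule LIMSEQ_power_zero) simp
    from tendsto_diff[OF tendsto_const this] show "(\<lambda>n. t - (1/2) ^ n) \<longlonglongrightarrow> t" by simp
  qed simp
  then have "(\<lambda>k. of_bool (digit t k) * (1/2) ^ Suc k) sums t" by (simp only: sums_def part)
  then show ?thesis unfolding binary_value_def by (rule sums_unique[symmetric])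
qed

section \<open>Spaces of p-integrable functions on the coin tossing space\<close>

definition Lp_coins :: "real \<Rightarrow> ((nat \<Rightarrow> bool) \<Rightarrow> complex) set"
  where "Lp_coins p = {f \<in> borel_measurable coins. integrable coins (\<lambda>\<omega>. cmod (f \<omega>) powr p)}"

definition powr_integral :: "real \<Rightarrow> ((nat \<Rightarrow> bool) \<Rightarrow> complex) \<Rightarrow> real"
  where "powr_integral p f = (\<integral>\<omega>. cmod (f \<omega>) powr p \<partial>coins)"

text \<open>A coarse form of Young's inequality, obtained by replacing both numbers by their
  maximum.\<close>

lemma mult_powr_le:
  fixes a b :: real
  assumes "a \<ge> 0" "b \<ge> 0" "p \<ge> 1"
  shows "a * b powr (p - 1) \<le> a powr p + b powr p"
proof -
  define m where "m = max a b"
  have m: "m \<ge> 0" "a \<le> m" "b \<le> m" using assms by (auto simp: m_def)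
  have "a * b powr (p - 1) \<le> m * m powr (p - 1)"
    using assms m by (intro mult_mono powr_mono2) auto
  also have "\<dots> = m powr p" using m(1) assms(3) by (simp add: powr_mult_base)
  also have "\<dots> \<le> a powr p + b powr p" by (auto simp: m_def max_def)
  finally show ?thesis .
qed

lemma powr_add_le:
  fixes a b :: real
  assumes "a \<ge> 0" "b \<ge> 0" "p \<ge> 0"
  shows "(a + b) powr p \<le> 2 powr p * (a powr p + b powr p)"
proof -
  have "(a + b) powr p \<le> (2 * max a b) powr p"
    using assms by (intro powr_mono2) auto
  also have "\<dots> = 2 powr p * max a b powr p" using assms by (simp add: powr_mult)
  also have "\<dots> \<le> 2 powr p * (a powr p + b powr p)" by (intro mult_left_mono) (auto simp: max_def)
  finally show ?thesis .
qed

lemma (in prob_space) integrable_if_powr_integrable: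
  fixes f :: "'a \<Rightarrow> complex"
  assumes "p \<ge> 1" and [measurable]: "f \<in> borel_measurable M" and "integrable M (\<lambda>x. cmod (f x) powr p)"
  shows "integrable M f"
proof (rule Bochner_Integration.integrable_bound)
  show "integrable M (\<lambda>x. cmod (f x) powr p + 1)" using assms by simp
  show "AE x in M. norm (f x) \<le> norm (cmod (f x) powr p + 1)"
    using mult_powr_le[of "cmod (f x)" 1 p for x] assms(1) by auto
qed measurable

text \<open>Jensen's inequality for the \<open>p\<close>-th power, by integrating the tangent
  inequality at the mean \<open>a\<close> of the modulus of \<open>f\<close>.\<close>

lemma (in prob_space) powr_norm_integral_le:
  fixes f :: "'a \<Rightarrow> complex"
  assumes p: "p > 1" and f: "f \<in> borel_measurable M" and fp: "integrable M (\<lambda>x. cmod (f x) powr p)"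
  shows "cmod (\<integral>x. f x \<partial>M) powr p \<le> (\<integral>x. cmod (f x) powr p \<partial>M)"
proof -
  have fi: "integrable M f" using integrable_if_powr_integrable[of p f] p f fp by simp
  define a where "a = (\<integral>x. cmod (f x) \<partial>M)"
  have a: "a \<ge> 0" by (simp add: a_def)
  define q where "q = p / (p - 1)"
  have q: "q > 1" "1/p + 1/q = 1" using p by (simp_all add: q_def field_simps)
  \<comment> \<open>Young's inequality with second factor \<open>a powr (p - 1)\<close>, whose
    \<open>q\<close>-th power is \<open>a powr p\<close>; equality holds at
    \<open>u = a\<close>.\<close>
  have tangent: "a powr (p - 1) * u \<le> u powr p / p + a powr p / q" if "u \<ge> 0" for u
    using Youngs_inequality[of p q u "a powr (p - 1)"] p q that
    by (simp add: powr_powr q_def mult.commute)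
  have "a powr (p - 1) * a = (\<integral>x. a powr (p - 1) * cmod (f x) \<partial>M)" using fi by (simp add: a_def)
  also have "\<dots> \<le> (\<integral>x. cmod (f x) powr p / p + a powr p / q \<partial>M)"
    using fi fp by (intro integral_mono tangent) auto
  also have "\<dots> = (\<integral>x. cmod (f x) powr p \<partial>M) / p + a powr p / q"
    using fp by (simp add: prob_space)
  finally have "a powr p \<le> (\<integral>x. cmod (f x) powr p \<partial>M) / p + a powr p / q"
    using powr_mult_base[OF a, of "p - 1"] by (simp add: mult.commute)
  then have "a powr p * (1 - 1/q) \<le> (\<integral>x. cmod (f x) powr p \<partial>M) / p" by (simp add: algebra_simps)
  moreover have "1 - 1/q = 1/p" using q by simp
  ultimately have "a powr p \<le> (\<integral>x. cmod (f x) powr p \<partial>M)" using p by (simp add: field_simps)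
  moreover have "cmod (\<integral>x. f x \<partial>M) powr p \<le> a powr p"
    using p by (intro powr_mono2) (auto simp: a_def)
  ultimately show ?thesis by simp
qed

lemma Lp_coins_measurable [measurable_dest]: "f \<in> Lp_coins p \<Longrightarrow> f \<in> borel_measurable coins"
  and Lp_coins_integrable: "f \<in> Lp_coins p \<Longrightarrow> integrable coins (\<lambda>\<omega>. cmod (f \<omega>) powr p)"
  by (simp_all add: Lp_coins_def)

lemma Lp_coins_add:
  assumes p: "p \<ge> 0" and f: "f \<in> Lp_coins p" and g: "g \<in> Lp_coins p"
  shows "(\<lambda>\<omega>. f \<omega> + g \<omega>) \<in> Lp_coins p"
proof -
  note [measurable] = Lp_coins_measurable[OF f] Lp_coins_measurable[OF g]
  have "integrable coins (\<lambda>\<omega>. cmod (f \<omega> + g \<omega>) powr p)"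
  proof (rule Bochner_Integration.integrable_bound)
    show "integrable coins (\<lambda>\<omega>. 2 powr p * (cmod (f \<omega>) powr p + cmod (g \<omega>) powr p))"
      using Lp_coins_integrable[OF f] Lp_coins_integrable[OF g] by simp
    have "cmod (f \<omega> + g \<omega>) powr p \<le> 2 powr p * (cmod (f \<omega>) powr p + cmod (g \<omega>) powr p)" for \<omega>
      using p by (intro order_trans[OF powr_mono2[OF _ _ norm_triangle_ineq] powr_add_le]) auto
    then show "AE \<omega> in coins. norm (cmod (f \<omega> + g \<omega>) powr p) \<le> norm (2 powr p * (cmod (f \<omega>) powr p + cmod (g \<omega>) powr p))"
      by simp
  qed measurable
  then show ?thesis by (simp add: Lp_coins_def)
qed

lemma Lp_coins_mult:
  assumes "f \<in> Lp_coins p"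
  shows "(\<lambda>\<omega>. c * f \<omega>) \<in> Lp_coins p"
  using assms by (auto simp: Lp_coins_def norm_mult powr_mult)

lemma Lp_coins_integrable_self: "p \<ge> 1 \<Longrightarrow> f \<in> Lp_coins p \<Longrightarrow> integrable coins f"
  by (rule coins.integrable_if_powr_integrable) (auto simp: Lp_coins_def)

lemma Lp_coins_indicator:
  assumes "C \<in> sets coins"
  shows "(\<lambda>\<omega>. of_bool (\<omega> \<in> C)) \<in> Lp_coins p"
proof -
  have "(\<lambda>\<omega>. cmod (of_bool (\<omega> \<in> C)) powr p) = indicator C" by (auto simp: indicator_def)
  with assms show ?thesis
    by (simp add: Lp_coins_def coins.emeasure_eq_measure integrable_indicator_iff of_bool_def)
qed

text \<open>For injective \<open>\<sigma>\<close>, composing this with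
  \<open>select \<sigma>\<close> gives the conditional expectation of \<open>f\<close> given the
  tosses in the range of \<open>\<sigma>\<close>.\<close>

definition section_mean :: "(nat \<Rightarrow> nat) \<Rightarrow> ((nat \<Rightarrow> bool) \<Rightarrow> complex) \<Rightarrow> (nat \<Rightarrow> bool) \<Rightarrow> complex"
  where "section_mean \<sigma> f \<omega> = (\<integral>\<omega>'. f (interleave \<sigma> (\<omega>, \<omega>')) \<partial>coins)"

lemma select_Lp:
  assumes "inj \<sigma>" "f \<in> Lp_coins p"
  shows "(\<lambda>\<omega>. f (select \<sigma> \<omega>)) \<in> Lp_coins p"
    and "powr_integral p (\<lambda>\<omega>. f (select \<sigma> \<omega>)) = powr_integral p f"
proof -
  note [measurable] = Lp_coins_measurable[OF assms(2)]
  have "integrable coins (\<lambda>\<omega>. cmod (f (select \<sigma> \<omega>)) powr p)"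
    using integrable_distr[OF measurable_select[of \<sigma>], of "\<lambda>\<omega>. cmod (f \<omega>) powr p"]
      Lp_coins_integrable[OF assms(2)] by (simp add: distr_select[OF assms(1)])
  then show "(\<lambda>\<omega>. f (select \<sigma> \<omega>)) \<in> Lp_coins p" by (simp add: Lp_coins_def)
  show "powr_integral p (\<lambda>\<omega>. f (select \<sigma> \<omega>)) = powr_integral p f"
    unfolding powr_integral_def
    using integral_distr[OF measurable_select[of \<sigma>], of "\<lambda>\<omega>. cmod (f \<omega>) powr p"]
    by (simp add: distr_select[OF assms(1)])
qed

lemma AE_select:
  assumes "inj \<sigma>" "AE \<omega> in coins. P \<omega>"
  shows "AE \<omega> in coins. P (select \<sigma> \<omega>)"
  by (rule AE_distrD[OF measurable_select]) (use assms in \<open>simp only: distr_select\<close>)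

lemma AE_interleave:
  assumes "inj \<sigma>" "AE \<omega> in coins. P \<omega>"
  shows "AE \<omega> in coins. AE \<omega>' in coins. P (interleave \<sigma> (\<omega>, \<omega>'))"
proof -
  have "AE x in coins \<Otimes>\<^sub>M coins. P (interleave \<sigma> x)"
    by (rule AE_distrD[OF measurable_interleave]) (use assms in \<open>simp only: distr_interleave\<close>)
  then show ?thesis by (rule coins_pair.AE_pair)
qed

lemma interleave_integrable:
  fixes f :: "(nat \<Rightarrow> bool) \<Rightarrow> 'a::{banach, second_countable_topology}"
  assumes "inj \<sigma>" "integrable coins f"
  shows "integrable (coins \<Otimes>\<^sub>M coins) (\<lambda>x. f (interleave \<sigma> x))"
  using integrable_distr[OF measurable_interleave[of \<sigma>], of f] assms by (simp add: distr_interleave)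

lemma section_mean_measurable:
  assumes [measurable]: "f \<in> borel_measurable coins"
  shows "section_mean \<sigma> f \<in> borel_measurable coins"
  unfolding section_mean_def by measurable

lemma AE_section_integrable:
  fixes f :: "(nat \<Rightarrow> bool) \<Rightarrow> 'a::{banach, second_countable_topology}"
  assumes "inj \<sigma>" "integrable coins f"
  shows "AE \<omega> in coins. integrable coins (\<lambda>\<omega>'. f (interleave \<sigma> (\<omega>, \<omega>')))"
  using coins_pair.AE_integrable_fst'[OF interleave_integrable[OF assms]] by simp

text \<open>Jensen's inequality on each section gives a pointwise bound; Fubini's theorem and the
  invariance of the measure under \<open>interleave \<sigma>\<close> turn it into a
  contraction.\<close>

lemma section_mean_Lp:
  assumes \<sigma>: "inj \<sigma>" and p: "p > 1" and f: "f \<in> Lp_coins p"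
  shows "section_mean \<sigma> f \<in> Lp_coins p"
    and "powr_integral p (section_mean \<sigma> f) \<le> powr_integral p f"
proof -
  note [measurable] = Lp_coins_measurable[OF f] section_mean_measurable
  let ?g = "\<lambda>\<omega>. cmod (f \<omega>) powr p"
  let ?h = "\<lambda>\<omega>. \<integral>\<omega>'. ?g (interleave \<sigma> (\<omega>, \<omega>')) \<partial>coins"
  have gi: "integrable coins ?g" by (rule Lp_coins_integrable[OF f])
  have hi: "integrable coins ?h"
    using coins_pair.integrable_fst'[OF interleave_integrable[OF \<sigma> gi]] .
  have le: "AE \<omega> in coins. cmod (section_mean \<sigma> f \<omega>) powr p \<le> ?h \<omega>"
    using AE_section_integrable[OF \<sigma> gi]
  proof eventually_elim
    case (elim \<omega>)
    then show ?case unfolding section_mean_def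
      by (intro coins.powr_norm_integral_le[OF p]) measurable
  qed
  have si: "integrable coins (\<lambda>\<omega>. cmod (section_mean \<sigma> f \<omega>) powr p)"
    by (rule Bochner_Integration.integrable_bound[OF hi]) (use le in auto)
  then show "section_mean \<sigma> f \<in> Lp_coins p" by (simp add: Lp_coins_def)
  have "powr_integral p (section_mean \<sigma> f) \<le> (\<integral>\<omega>. ?h \<omega> \<partial>coins)"
    unfolding powr_integral_def by (rule integral_mono_AE[OF si hi le])
  also have "\<dots> = (\<integral>x. ?g (interleave \<sigma> x) \<partial>(coins \<Otimes>\<^sub>M coins))"
    by (rule coins_pair.integral_fst'[OF interleave_integrable[OF \<sigma> gi]])
  also have "\<dots> = powr_integral p f"
    unfolding powr_integral_def
    using integral_distr[OF measurable_interleave[of \<sigma>], of ?g] by (simp add: distr_interleave[OF \<sigma>])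
  finally show "powr_integral p (section_mean \<sigma> f) \<le> powr_integral p f" .
qed

lemma section_mean_add:
  assumes "inj \<sigma>" "integrable coins f" "integrable coins g"
  shows "AE \<omega> in coins. section_mean \<sigma> (\<lambda>\<omega>. f \<omega> + g \<omega>) \<omega> = section_mean \<sigma> f \<omega> + section_mean \<sigma> g \<omega>"
  using AE_section_integrable[OF assms(1,2)] AE_section_integrable[OF assms(1,3)]
  by eventually_elim (simp add: section_mean_def)

lemma section_mean_cong:
  assumes "inj \<sigma>" "AE \<omega> in coins. f \<omega> = g \<omega>"
    and [measurable]: "f \<in> borel_measurable coins" "g \<in> borel_measurable coins"
  shows "AE \<omega> in coins. section_mean \<sigma> f \<omega> = section_mean \<sigma> g \<omega>"
  using AE_interleave[OF assms(1,2)]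
proof eventually_elim
  case (elim \<omega>)
  then show ?case unfolding section_mean_def by (intro integral_cong_AE) measurable
qed

text \<open>\<open>rep\<close> chooses one function from each class, so the linear laws hold only
  almost everywhere, with exceptional sets that may depend on the vectors. The norm enters through
  its \<open>p\<close>-th power to avoid roots.\<close>

locale Lp_representation =
  fixes p :: real and rep :: "'a::complex_banach \<Rightarrow> (nat \<Rightarrow> bool) \<Rightarrow> complex"
  assumes p: "p > 1"
    and rep: "rep x \<in> Lp_coins p"
    and norm_rep: "norm x powr p = powr_integral p (rep x)"
    and rep_add: "AE \<omega> in coins. rep (x + y) \<omega> = rep x \<omega> + rep y \<omega>"
    and rep_scaleC: "AE \<omega> in coins. rep (c *\<^sub>C x) \<omega> = c * rep x \<omega>"
    and rep_surj: "f \<in> Lp_coins p \<Longrightarrow> \<exists>x. AE \<omega> in coins. rep x \<omega> = f \<omega>"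
begin

lemma measurable_rep [measurable]: "rep x \<in> borel_measurable coins"
  by (rule Lp_coins_measurable[OF rep])

lemma rep_0: "AE \<omega> in coins. rep 0 \<omega> = 0"
  using rep_scaleC[of 0 0] by (simp add: complex_vector.scale_zero_left)

lemma rep_eqI:
  assumes "AE \<omega> in coins. rep x \<omega> = rep y \<omega>"
  shows "x = y"
proof -
  have eq: "x - y = x + (-1) *\<^sub>C y" by (simp add: complex_vector.scale_minus_left scaleC_one)
  have "AE \<omega> in coins. rep (x - y) \<omega> = 0"
    unfolding eq using assms rep_add[of x "(-1) *\<^sub>C y"] rep_scaleC[of "-1" y] by eventually_elim simp
  then have "AE \<omega> in coins. cmod (rep (x - y) \<omega>) powr p = 0" by eventually_elim simp
  then have "powr_integral p (rep (x - y)) = 0"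
    unfolding powr_integral_def by (subst integral_cong_AE[where g = "\<lambda>_. 0"]) auto
  then have "norm (x - y) powr p = 0" by (simp add: norm_rep)
  then show ?thesis by simp
qed

text \<open>Passage from functions to vectors: the values come from \<open>rep_surj\<close>, and
  \<open>rep_eqI\<close> turns the laws for \<open>\<Phi>\<close>, valid almost everywhere, into
  linearity.\<close>

lemma operator_exists:
  assumes Lp: "\<And>f. f \<in> Lp_coins p \<Longrightarrow> \<Phi> f \<in> Lp_coins p"
    and contraction: "\<And>f. f \<in> Lp_coins p \<Longrightarrow> powr_integral p (\<Phi> f) \<le> powr_integral p f"
    and add: "\<And>f g. f \<in> Lp_coins p \<Longrightarrow> g \<in> Lp_coins p \<Longrightarrow>
      AE \<omega> in coins. \<Phi> (\<lambda>\<omega>. f \<omega> + g \<omega>) \<omega> = \<Phi> f \<omega> + \<Phi> g \<omega>"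
    and mult: "\<And>c f. f \<in> Lp_coins p \<Longrightarrow> AE \<omega> in coins. \<Phi> (\<lambda>\<omega>. c * f \<omega>) \<omega> = c * \<Phi> f \<omega>"
    and cong: "\<And>f g. f \<in> Lp_coins p \<Longrightarrow> g \<in> Lp_coins p \<Longrightarrow> AE \<omega> in coins. f \<omega> = g \<omega> \<Longrightarrow>
      AE \<omega> in coins. \<Phi> f \<omega> = \<Phi> g \<omega>"
  shows "\<exists>W :: 'a \<Rightarrow>\<^sub>C\<^sub>L 'a. \<forall>x. AE \<omega> in coins. rep (cblinfun_apply W x) \<omega> = \<Phi> (rep x) \<omega>"
proof -
  have "\<forall>x. \<exists>y. AE \<omega> in coins. rep y \<omega> = \<Phi> (rep x) \<omega>" using rep_surj Lp rep by blast
  then obtain W where W: "\<And>x. AE \<omega> in coins. rep (W x) \<omega> = \<Phi> (rep x) \<omega>"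
    unfolding choice_iff by blast
  have lin: "clinear W"
    unfolding clinear_iff
  proof (intro conjI allI)
    fix x y c
    have "(\<lambda>\<omega>. rep x \<omega> + rep y \<omega>) \<in> Lp_coins p" using p rep by (intro Lp_coins_add) auto
    from cong[OF rep this rep_add] add[OF rep[of x] rep[of y]] W[of "x + y"] W[of x] W[of y] rep_add[of "W x" "W y"]
    have "AE \<omega> in coins. rep (W (x + y)) \<omega> = rep (W x + W y) \<omega>" by eventually_elim simp
    then show "W (x + y) = W x + W y" by (rule rep_eqI)
    from cong[OF rep Lp_coins_mult[OF rep] rep_scaleC[of c x]] mult[OF rep[of x], of c] W[of "c *\<^sub>C x"] W[of x]
      rep_scaleC[of c "W x"]
    have "AE \<omega> in coins. rep (W (c *\<^sub>C x)) \<omega> = rep (c *\<^sub>C W x) \<omega>" by eventually_elim simp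
    then show "W (c *\<^sub>C x) = c *\<^sub>C W x" by (rule rep_eqI)
  qed
  have "norm (W x) \<le> 1 * norm x" for x
  proof -
    have [measurable]: "\<Phi> (rep x) \<in> borel_measurable coins" by (rule Lp_coins_measurable[OF Lp[OF rep]])
    have "norm (W x) powr p = powr_integral p (\<Phi> (rep x))"
      unfolding norm_rep powr_integral_def using W[of x] by (intro integral_cong_AE) (measurable, auto)
    also have "\<dots> \<le> norm x powr p" unfolding norm_rep by (rule contraction[OF rep])
    finally show ?thesis using p by (metis less_trans mult_1 norm_ge_zero not_le powr_less_mono2 zero_less_one)
  qed
  from cblinfun_of_apply_bound[OF lin this] W show ?thesis
    by (intro exI[of _ "cblinfun_of W"]) simp
qed

lemma selection_operator:
  assumes "inj \<sigma>"
  shows "\<exists>U :: 'a \<Rightarrow>\<^sub>C\<^sub>L 'a. \<forall>x. AE \<omega> in coins. rep (cblinfun_apply U x) \<omega> = rep x (select \<sigma> \<omega>)"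
proof (rule operator_exists[where \<Phi> = "\<lambda>f \<omega>. f (select \<sigma> \<omega>)"])
  show "AE \<omega> in coins. f (select \<sigma> \<omega>) = g (select \<sigma> \<omega>)" if "AE \<omega> in coins. f \<omega> = g \<omega>"
    for f g :: "(nat \<Rightarrow> bool) \<Rightarrow> complex"
    using AE_select[OF assms that] .
qed (use select_Lp[OF assms] in auto)

lemma mean_operator:
  assumes "inj \<sigma>"
  shows "\<exists>V :: 'a \<Rightarrow>\<^sub>C\<^sub>L 'a. \<forall>x. AE \<omega> in coins. rep (cblinfun_apply V x) \<omega> = section_mean \<sigma> (rep x) \<omega>"
proof (rule operator_exists)
  show "AE \<omega> in coins. section_mean \<sigma> (\<lambda>\<omega>. f \<omega> + g \<omega>) \<omega> = section_mean \<sigma> f \<omega> + section_mean \<sigma> g \<omega>"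
    if "f \<in> Lp_coins p" "g \<in> Lp_coins p" for f g
    using that p by (intro section_mean_add[OF assms] Lp_coins_integrable_self[of p]) auto
  show "AE \<omega> in coins. section_mean \<sigma> (\<lambda>\<omega>. c * f \<omega>) \<omega> = c * section_mean \<sigma> f \<omega>" for c f
    by (simp add: section_mean_def)
  show "AE \<omega> in coins. section_mean \<sigma> f \<omega> = section_mean \<sigma> g \<omega>"
    if "f \<in> Lp_coins p" "g \<in> Lp_coins p" "AE \<omega> in coins. f \<omega> = g \<omega>" for f g
    using section_mean_cong[OF assms that(3)] that(1,2) Lp_coins_measurable by blast
qed (use section_mean_Lp[OF assms p] in auto)

text \<open>The extremal function of Hoelder's inequality: its product with \<open>rep z\<close> is
  the \<open>p\<close>-th power of the modulus of \<open>rep z\<close>.\<close>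

definition dual_density :: "'a \<Rightarrow> (nat \<Rightarrow> bool) \<Rightarrow> complex"
  where "dual_density z \<omega> = cnj (sgn (rep z \<omega>)) * complex_of_real (cmod (rep z \<omega>) powr (p - 1))"

definition pairing :: "'a \<Rightarrow> 'a \<Rightarrow> complex"
  where "pairing z y = (\<integral>\<omega>. rep y \<omega> * dual_density z \<omega> \<partial>coins)"

lemma measurable_dual_density [measurable]: "dual_density z \<in> borel_measurable coins"
proof -
  have [measurable]: "cnj \<in> borel_measurable borel"
    by (intro borel_measurable_continuous_onI continuous_on_cnj continuous_on_id)
  show ?thesis unfolding dual_density_def[abs_def] sgn_div_norm by measurable
qed

lemma norm_pairing_integrand_le:
  "cmod (rep y \<omega> * dual_density z \<omega>) \<le> cmod (rep y \<omega>) powr p + cmod (rep z \<omega>) powr p"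
proof -
  have "cmod (rep y \<omega> * dual_density z \<omega>) \<le> cmod (rep y \<omega>) * cmod (rep z \<omega>) powr (p - 1)"
    by (simp add: dual_density_def norm_mult norm_sgn)
  also have "\<dots> \<le> cmod (rep y \<omega>) powr p + cmod (rep z \<omega>) powr p"
    using p by (intro mult_powr_le) auto
  finally show ?thesis .
qed

lemma pairing_integrable: "integrable coins (\<lambda>\<omega>. rep y \<omega> * dual_density z \<omega>)"
  and norm_pairing_le: "cmod (pairing z y) \<le> norm y powr p + norm z powr p"
proof -
  have b: "integrable coins (\<lambda>\<omega>. cmod (rep y \<omega>) powr p + cmod (rep z \<omega>) powr p)"
    using Lp_coins_integrable[OF rep] by simp
  show i: "integrable coins (\<lambda>\<omega>. rep y \<omega> * dual_density z \<omega>)"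
    by (rule Bochner_Integration.integrable_bound[OF b])
      (measurable, use norm_pairing_integrand_le in \<open>auto intro!: AE_I2\<close>)
  have "cmod (pairing z y) \<le> (\<integral>\<omega>. cmod (rep y \<omega> * dual_density z \<omega>) \<partial>coins)"
    unfolding pairing_def by (rule integral_norm_bound)
  also have "\<dots> \<le> (\<integral>\<omega>. cmod (rep y \<omega>) powr p + cmod (rep z \<omega>) powr p \<partial>coins)"
    by (rule integral_mono[OF integrable_norm[OF i] b norm_pairing_integrand_le])
  also have "\<dots> = norm y powr p + norm z powr p"
    using Lp_coins_integrable[OF rep] by (simp add: norm_rep powr_integral_def)
  finally show "cmod (pairing z y) \<le> norm y powr p + norm z powr p" .
qed

lemma pairing_cong:
  assumes "AE \<omega> in coins. rep y \<omega> * dual_density z \<omega> = g \<omega>" "g \<in> borel_measurable coins"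
  shows "pairing z y = (\<integral>\<omega>. g \<omega> \<partial>coins)"
  unfolding pairing_def by (rule integral_cong_AE) (use assms in auto)

lemma clinear_pairing: "clinear (pairing z)"
  unfolding clinear_iff
proof (intro conjI allI)
  fix x y c
  have "AE \<omega> in coins. rep (x + y) \<omega> * dual_density z \<omega> = rep x \<omega> * dual_density z \<omega> + rep y \<omega> * dual_density z \<omega>"
    using rep_add[of x y] by eventually_elim (simp add: distrib_right)
  from pairing_cong[OF this] show "pairing z (x + y) = pairing z x + pairing z y"
    using pairing_integrable by (simp add: pairing_def)
  have "AE \<omega> in coins. rep (c *\<^sub>C x) \<omega> * dual_density z \<omega> = c * (rep x \<omega> * dual_density z \<omega>)"
    using rep_scaleC[of c x] by eventually_elim simp
  from pairing_cong[OF this] show "pairing z (c *\<^sub>C x) = c *\<^sub>C pairing z x"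
    by (simp add: pairing_def scaleC_complex_def)
qed

definition dual_fun :: "'a \<Rightarrow> 'a \<Rightarrow>\<^sub>C\<^sub>L complex"
  where "dual_fun z = cblinfun_of (pairing z)"

lemma dual_fun_apply: "cblinfun_apply (dual_fun z) y = pairing z y"
  and norm_dual_fun_le: "norm (dual_fun z) \<le> 1 + norm z powr p"
proof -
  \<comment> \<open>The bound \<open>norm_pairing_le\<close> is not homogeneous in \<open>y\<close>,
    so it is applied to \<open>y\<close> scaled to norm 1.\<close>
  have bd: "cmod (pairing z y) \<le> (1 + norm z powr p) * norm y" for y
  proof (cases "y = 0")
    case False
    have "pairing z ((1 / norm y) *\<^sub>R y) = (1 / norm y) *\<^sub>R pairing z y"
      by (rule clinear_scaleR[OF clinear_pairing])
    then have "cmod (pairing z y) / norm y \<le> 1 + norm z powr p"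
      using norm_pairing_le[of z "(1 / norm y) *\<^sub>R y"] False by simp
    then show ?thesis using False by (simp add: field_simps)
  next
    case True
    then show ?thesis using clinear_scaleR[OF clinear_pairing, of z 0 0] by simp
  qed
  from cblinfun_of_apply_bound[OF clinear_pairing bd]
  have ap: "cblinfun_apply (dual_fun z) = pairing z" by (simp add: dual_fun_def)
  then show "cblinfun_apply (dual_fun z) y = pairing z y" by simp
  show "norm (dual_fun z) \<le> 1 + norm z powr p" by (rule norm_cblinfun_le) (use bd ap in auto)
qed

lemma pairing_self: "pairing z z = complex_of_real (norm z powr p)"
proof -
  have "rep z \<omega> * dual_density z \<omega> = complex_of_real (cmod (rep z \<omega>) powr p)" for \<omega>
  proof -
    have "w * cnj (sgn w) = complex_of_real (cmod w)" for w :: complex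
      by (simp add: sgn_div_norm scaleR_conv_of_real field_simps flip: complex_norm_square) (simp add: power2_eq_square)
    then have "rep z \<omega> * dual_density z \<omega> = complex_of_real (cmod (rep z \<omega>) * cmod (rep z \<omega>) powr (p - 1))"
      by (simp add: dual_density_def flip: mult.assoc)
    then show ?thesis using p by (simp add: powr_mult_base)
  qed
  then show ?thesis by (simp add: pairing_def norm_rep powr_integral_def)
qed

lemma norming: "norming_dual TYPE('a)"
proof -
  \<comment> \<open>For \<open>norm z = 1\<close> the functional \<open>dual_fun z\<close> has norm
    at most \<open>1 + 1\<close>, whence the factor 1/2.\<close>
  have "\<exists>f. norm f \<le> 1 \<and> (1/2) * norm x \<le> cmod (cblinfun_apply f x)" for x :: 'a
  proof (cases "x = 0")
    case False
    define z where "z = (1 / norm x) *\<^sub>R x"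
    have nz: "norm z = 1" and x: "x = norm x *\<^sub>R z" using False by (simp_all add: z_def)
    have "pairing z x = norm x *\<^sub>R pairing z z"
      by (subst x) (rule clinear_scaleR[OF clinear_pairing])
    then have "cmod (pairing z x) = norm x" by (simp add: pairing_self nz)
    then show ?thesis
      using norm_dual_fun_le[of z] nz
      by (intro exI[of _ "(1/2) *\<^sub>R dual_fun z"]) (simp add: cblinfun_apply_scaleR dual_fun_apply)
  qed (auto intro: exI[of _ 0])
  then show ?thesis unfolding norming_dual_def by (intro exI[of _ "1/2"]) simp
qed

section \<open>Operators whose values depend on finitely many tosses\<close>

lemma rep_sum:
  assumes "finite I"
  shows "AE \<omega> in coins. rep (\<Sum>i\<in>I. a i *\<^sub>C e i) \<omega> = (\<Sum>i\<in>I. a i * rep (e i) \<omega>)"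
  using assms
proof induction
  case empty
  then show ?case using rep_0 by simp
next
  case (insert i I)
  from insert.IH rep_add[of "a i *\<^sub>C e i" "\<Sum>i\<in>I. a i *\<^sub>C e i"] rep_scaleC[of "a i" "e i"]
  have "AE \<omega> in coins. rep (a i *\<^sub>C e i + (\<Sum>i\<in>I. a i *\<^sub>C e i)) \<omega> = a i * rep (e i) \<omega> + (\<Sum>i\<in>I. a i * rep (e i) \<omega>)"
    by eventually_elim simp
  then show ?case using insert.hyps by simp
qed

text \<open>The images are almost everywhere constant on each of the finitely many cylinders that
  fix the tosses in \<open>K\<close>, hence combinations of their indicators. The coefficients come
  from pairing with these indicators, so they are bounded functionals.\<close>

lemma finite_rank_if_finitely_determined:
  fixes W :: "'a \<Rightarrow>\<^sub>C\<^sub>L 'a"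
  assumes K: "finite K"
    and W: "\<And>x. AE \<omega> in coins. rep (cblinfun_apply W x) \<omega> = H x \<omega>"
    and H: "\<And>x \<omega> \<omega>'. (\<And>n. n \<in> K \<Longrightarrow> \<omega> n = \<omega>' n) \<Longrightarrow> H x \<omega> = H x \<omega>'"
  shows "W \<in> finite_rank_ops"
proof -
  let ?a = cblinfun_apply
  \<comment> \<open>\<open>I\<close> holds one assignment per pattern on \<open>K\<close>. Each is a
    total function and thus also a sample point for \<open>H x\<close>, which ignores the tosses
    outside \<open>K\<close>.\<close>
  define I where "I = PiE K (\<lambda>_. UNIV :: bool set)"
  have I: "finite I" using K by (simp add: I_def finite_PiE)
  define C where "C c = {\<omega>. \<forall>n\<in>K. \<omega> n \<in> {c n}}" for c :: "nat \<Rightarrow> bool"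
  have C [measurable]: "C c \<in> sets coins" for c unfolding C_def by (rule sets_coins_cylinder[OF K])
  have "emeasure coins (C c) \<noteq> 0" for c
    unfolding C_def emeasure_coins_cylinder[OF K] emeasure_fair_coin by (simp add: prod_zero_iff[OF K])
  then have m: "measure coins (C c) \<noteq> 0" for c by (simp add: coins.emeasure_eq_measure)
  have "\<forall>c. \<exists>e. AE \<omega> in coins. rep e \<omega> = of_bool (\<omega> \<in> C c)"
    using rep_surj[OF Lp_coins_indicator[OF C]] by blast
  then obtain e where e: "\<And>c. AE \<omega> in coins. rep (e c) \<omega> = of_bool (\<omega> \<in> C c)"
    unfolding choice_iff by blast
  have HC: "H x \<omega> = H x c" if "\<omega> \<in> C c" for x \<omega> c
    using that by (intro H) (auto simp: C_def)
  \<comment> \<open>The dual density of an indicator is that indicator, so the pairing integrates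
    the constant \<open>H x c\<close> over the cylinder.\<close>
  have pair: "pairing (e c) (?a W x) = H x c * complex_of_real (measure coins (C c))" for c x
  proof -
    have "AE \<omega> in coins. rep (?a W x) \<omega> * dual_density (e c) \<omega> = H x c * complex_of_real (indicator (C c) \<omega>)"
      using W[of x] e[of c]
    proof eventually_elim
      case (elim \<omega>)
      then show ?case by (cases "\<omega> \<in> C c") (simp_all add: dual_density_def HC)
    qed
    then have "pairing (e c) (?a W x) = (\<integral>\<omega>. H x c * complex_of_real (indicator (C c) \<omega>) \<partial>coins)"
      by (rule pairing_cong) measurable
    then show ?thesis by simp
  qed
  let ?R = "\<Sum>c\<in>I. rank_one_op ((1 / complex_of_real (measure coins (C c))) *\<^sub>C e c) (dual_fun (e c) o\<^sub>C\<^sub>L W)"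
  have "W = ?R"
  proof (rule cblinfun_eqI)
    fix x
    have sum_apply: "?a (\<Sum>j\<in>I. F j) x = (\<Sum>j\<in>I. ?a (F j) x)" for F :: "(nat \<Rightarrow> bool) \<Rightarrow> 'a \<Rightarrow>\<^sub>C\<^sub>L 'a"
      using I by (induction I) (auto simp: cblinfun_apply_add)
    have Rx: "?a ?R x = (\<Sum>c\<in>I. H x c *\<^sub>C e c)"
      by (simp add: sum_apply rank_one_op_apply cblinfun_apply_compose dual_fun_apply pair scaleC_scaleC m)
    have "AE \<omega> in coins. \<forall>c\<in>I. rep (e c) \<omega> = of_bool (\<omega> \<in> C c)"
      using e by (intro AE_finite_allI[OF I]) auto
    with rep_sum[OF I, of "H x" e] W[of x]
    have "AE \<omega> in coins. rep (?a W x) \<omega> = rep (\<Sum>c\<in>I. H x c *\<^sub>C e c) \<omega>"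
    proof eventually_elim
      case (elim \<omega>)
      have "(\<Sum>c\<in>I. H x c * rep (e c) \<omega>) = (\<Sum>c\<in>I. if c = restrict \<omega> K then H x \<omega> else 0)"
      proof (rule sum.cong)
        fix c assume c: "c \<in> I"
        then have "\<omega> \<in> C c \<longleftrightarrow> c = restrict \<omega> K"
          by (auto simp: C_def I_def restrict_def PiE_def extensional_def fun_eq_iff)
        then show "H x c * rep (e c) \<omega> = (if c = restrict \<omega> K then H x \<omega> else 0)"
          using elim c HC[of \<omega> c x] by auto
      qed simp
      also have "\<dots> = H x \<omega>" using I by (simp add: I_def)
      finally show ?case using elim by simp
    qed
    then show "?a W x = ?a ?R x" unfolding Rx by (rule rep_eqI)
  qed
  also have "?R \<in> finite_rank_ops" unfolding finite_rank_ops_def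
    by (rule complex_vector.span_sum, rule complex_vector.span_base) blast
  finally show ?thesis .
qed

lemma Lp_almost_orthogonal_copies:
  obtains U V :: "(nat \<Rightarrow> bool) \<Rightarrow> ('a \<Rightarrow>\<^sub>C\<^sub>L 'a)" where "almost_orthogonal_copies U V"
proof -
  let ?a = cblinfun_apply
  define \<sigma> where "\<sigma> = prefix_code"
  have inj: "inj (\<sigma> s)" for s by (simp add: \<sigma>_def strict_mono_imp_inj_on strict_mono_prefix_code)
  obtain U where U: "\<And>s x. AE \<omega> in coins. rep (?a (U s) x) \<omega> = rep x (select (\<sigma> s) \<omega>)"
    using selection_operator[OF inj] by metis
  obtain V where V: "\<And>s x. AE \<omega> in coins. rep (?a (V s) x) \<omega> = section_mean (\<sigma> s) (rep x) \<omega>"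
    using mean_operator[OF inj] by metis
  have VU: "AE \<omega> in coins. rep (?a (V s) (?a (U t) x)) \<omega> =
      section_mean (\<sigma> s) (\<lambda>\<omega>. rep x (select (\<sigma> t) \<omega>)) \<omega>" for s t x
  proof -
    have "AE \<omega> in coins. section_mean (\<sigma> s) (rep (?a (U t) x)) \<omega> =
        section_mean (\<sigma> s) (\<lambda>\<omega>. rep x (select (\<sigma> t) \<omega>)) \<omega>"
      by (rule section_mean_cong[OF inj U]) measurable
    with V[of s "?a (U t) x"] show ?thesis by eventually_elim simp
  qed
  \<comment> \<open>Selecting what was just interleaved returns \<open>\<omega>\<close>, so the mean
    is taken over a constant.\<close>
  have "?a (V s) (?a (U s) x) = x" for s x
    by (rule rep_eqI) (use VU[of s s x] in \<open>simp add: section_mean_def select_interleave[OF inj] coins.prob_space[simplified]\<close>)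
  moreover have "V s o\<^sub>C\<^sub>L U t \<in> finite_rank_ops" if "s \<noteq> t" for s t
  proof (rule finite_rank_if_finitely_determined)
    show "finite {n. \<sigma> s n \<in> range (\<sigma> t)}" using finite_prefix_code_meet[OF that] by (simp add: \<sigma>_def)
    show "AE \<omega> in coins. rep (?a (V s o\<^sub>C\<^sub>L U t) x) \<omega> =
        section_mean (\<sigma> s) (\<lambda>\<omega>. rep x (select (\<sigma> t) \<omega>)) \<omega>" for x
      using VU by (simp add: cblinfun_apply_compose)
    fix x and \<omega> \<omega>' :: "nat \<Rightarrow> bool"
    assume eq: "\<And>n. n \<in> {n. \<sigma> s n \<in> range (\<sigma> t)} \<Longrightarrow> \<omega> n = \<omega>' n"
    \<comment> \<open>A toss read by \<open>select (\<sigma> t)\<close> comes from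
      \<open>\<omega>\<close> only if its index lies in both ranges; otherwise it is a toss of
      \<open>\<eta>\<close>, which is integrated out.\<close>
    have "select (\<sigma> t) (interleave (\<sigma> s) (\<omega>, \<eta>)) = select (\<sigma> t) (interleave (\<sigma> s) (\<omega>', \<eta>))" for \<eta>
    proof
      fix k
      have "\<omega> (inv (\<sigma> s) (\<sigma> t k)) = \<omega>' (inv (\<sigma> s) (\<sigma> t k))" if "\<sigma> t k \<in> range (\<sigma> s)"
        using that by (intro eq) (simp add: f_inv_into_f)
      then show "select (\<sigma> t) (interleave (\<sigma> s) (\<omega>, \<eta>)) k = select (\<sigma> t) (interleave (\<sigma> s) (\<omega>', \<eta>)) k"
        by (simp add: select_def interleave_def)
    qed
    then show "section_mean (\<sigma> s) (\<lambda>\<omega>. rep x (select (\<sigma> t) \<omega>)) \<omega> =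
        section_mean (\<sigma> s) (\<lambda>\<omega>. rep x (select (\<sigma> t) \<omega>)) \<omega>'"
      by (simp add: section_mean_def)
  qed
  ultimately show ?thesis using that[of U V] by (simp add: almost_orthogonal_copies_def)
qed

end

section \<open>From the unit interval to coin tossing\<close>

text \<open>Lebesgue measurability need not survive composition with \<open>binary_value\<close>;
  Borel measurability of the outer function does suffice.\<close>

lemma borel_representative:
  fixes f :: "real \<Rightarrow> complex"
  assumes "f \<in> borel_measurable unit_interval"
  obtains g where "g \<in> borel_measurable borel" "AE t in unit_interval. f t = g t"
proof -
  define h where "h t = indicator {0..1} t *\<^sub>R f t" for t :: real
  have [measurable]: "h \<in> borel_measurable lebesgue"
    using assms by (subst (asm) borel_measurable_restrict_space_iff) (simp_all add: h_def[abs_def])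
  have "(\<lambda>t. Re (h t)) \<in> borel_measurable lebesgue" "(\<lambda>t. Im (h t)) \<in> borel_measurable lebesgue"
    by measurable
  then obtain u v where [measurable]: "u \<in> borel_measurable lborel" "v \<in> borel_measurable lborel"
    and uv: "AE t in lborel. Re (h t) = u t" "AE t in lborel. Im (h t) = v t"
    using completion_ex_borel_measurable_real by metis
  define g where "g t = complex_of_real (u t) + \<i> * complex_of_real (v t)" for t
  have "g \<in> borel_measurable borel" unfolding g_def by measurable
  moreover have "AE t in unit_interval. f t = g t"
  proof -
    have "AE t in lebesgue. h t = g t"
      using AE_completion[OF uv(1)] AE_completion[OF uv(2)]
      by eventually_elim (simp add: g_def complex_eq_iff)
    then have "AE t in lebesgue. t \<in> {0..1} \<longrightarrow> f t = g t"
      by eventually_elim (auto simp: h_def indicator_def)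
    then show ?thesis by (simp add: AE_restrict_space_iff)
  qed
  ultimately show ?thesis using that by blast
qed

lemma AE_binary_value_digit: "AE t in unit_interval. binary_value (digit t) = t"
proof -
  have "AE t in lebesgue. t \<noteq> (1::real)" by (rule AE_completion) (rule AE_lborel_singleton)
  then have "AE t in lebesgue. t \<in> {0..1} \<longrightarrow> binary_value (digit t) = t"
    by eventually_elim (auto intro: binary_value_digit)
  then show ?thesis by (simp add: AE_restrict_space_iff)
qed

text \<open>The coin tossing measure is the image of Lebesgue measure under \<open>digit\<close>, so
  a measurable exceptional set can be tested on the interval.\<close>

lemma AE_coins_eqI:
  fixes F G :: "(nat \<Rightarrow> bool) \<Rightarrow> complex"
  assumes "F \<in> borel_measurable coins" "G \<in> borel_measurable coins"
    and "AE t in unit_interval. F (digit t) = G (digit t)"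
  shows "AE \<omega> in coins. F \<omega> = G \<omega>"
proof -
  have "{\<omega> \<in> space coins. F \<omega> = G \<omega>} \<in> sets coins"
    using borel_measurable_eq[of "\<lambda>\<omega>. cmod (F \<omega> - G \<omega>)" coins "\<lambda>_. 0"] assms(1,2) by simp
  then have "AE \<omega> in distr unit_interval coins digit. F \<omega> = G \<omega>"
    using assms(3) by (subst AE_distr_iff) simp_all
  then show ?thesis by (simp only: distr_digit)
qed

lemma integral_coins_eq:
  fixes F :: "(nat \<Rightarrow> bool) \<Rightarrow> real"
  assumes [measurable]: "F \<in> borel_measurable coins"
  shows "integrable coins F \<longleftrightarrow> integrable unit_interval (\<lambda>t. F (digit t))"
    and "(\<integral>\<omega>. F \<omega> \<partial>coins) = (\<integral>t. F (digit t) \<partial>unit_interval)"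
  using integrable_distr_eq[OF measurable_digit_unit_interval assms]
    integral_distr[OF measurable_digit_unit_interval assms]
  by (simp_all only: distr_digit)

lemma Lp_representation_exists:
  assumes p: "1 < p" and Lp: "is_Lp_space p TYPE('a::complex_banach)"
  obtains rep :: "'a::complex_banach \<Rightarrow> (nat \<Rightarrow> bool) \<Rightarrow> complex" where "Lp_representation p rep"
proof -
  obtain J :: "'a \<Rightarrow> (real \<Rightarrow> complex) set" where J: "bij_betw J UNIV (Lp_space p)"
    and J_add: "\<And>x y f g. f \<in> J x \<Longrightarrow> g \<in> J y \<Longrightarrow> (\<lambda>t. f t + g t) \<in> J (x + y)"
    and J_scale: "\<And>c x f. f \<in> J x \<Longrightarrow> (\<lambda>t. c * f t) \<in> J (c *\<^sub>C x)"
    and J_norm: "\<And>x f. f \<in> J x \<Longrightarrow> norm x = Lp_norm p f"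
    using Lp unfolding is_Lp_space_def by blast
  have "\<forall>x. \<exists>f. f \<in> Lp_functions p \<and>
      J x = {g \<in> Lp_functions p. AE t in unit_interval. f t = g t}"
  proof
    fix x
    have "J x \<in> Lp_space p" using J by (auto simp: bij_betw_def)
    then obtain f where "f \<in> Lp_functions p"
      "J x = {(f, g). f \<in> Lp_functions p \<and> g \<in> Lp_functions p \<and> (AE t in unit_interval. f t = g t)} `` {f}"
      unfolding Lp_space_def by (rule quotientE)
    then show "\<exists>f. f \<in> Lp_functions p \<and> J x = {g \<in> Lp_functions p. AE t in unit_interval. f t = g t}"
      by (intro exI[of _ f]) auto
  qed
  then obtain f where f: "\<And>x. f x \<in> Lp_functions p"
    and Jf: "\<And>x. J x = {g \<in> Lp_functions p. AE t in unit_interval. f x t = g t}"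
    unfolding choice_iff by blast
  have fJ: "f x \<in> J x" for x using f by (simp add: Jf)
  have f_meas [measurable]: "f x \<in> borel_measurable unit_interval"
    and f_int: "integrable unit_interval (\<lambda>t. cmod (f x t) powr p)" for x
    using f[of x] by (auto simp: Lp_functions_def)
  have "\<forall>x. \<exists>g. g \<in> borel_measurable borel \<and> (AE t in unit_interval. f x t = g t)"
    using borel_representative[OF f_meas] by metis
  then obtain g where g_meas [measurable]: "\<And>x. g x \<in> borel_measurable borel"
    and fg: "\<And>x. AE t in unit_interval. f x t = g x t"
    unfolding choice_iff by blast
  \<comment> \<open>Reading tosses as binary digits carries functions on the interval to the coin
    space; composing with \<open>digit\<close> returns \<open>f x\<close> almost everywhere.\<close>
  define rep where "rep x \<omega> = g x (binary_value \<omega>)" for x \<omega>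
  have rep_meas [measurable]: "rep x \<in> borel_measurable coins" for x unfolding rep_def by measurable
  have rep_f: "AE t in unit_interval. rep x (digit t) = f x t" for x
    using fg[of x] AE_binary_value_digit by eventually_elim (simp add: rep_def)
  have powr_meas: "(\<lambda>\<omega>. cmod (rep x \<omega>) powr p) \<in> borel_measurable coins" for x by measurable
  have powr_f: "AE t in unit_interval. cmod (rep x (digit t)) powr p = cmod (f x t) powr p" for x
    using rep_f[of x] by eventually_elim simp
  have powr_digit_meas: "(\<lambda>t. cmod (rep x (digit t)) powr p) \<in> borel_measurable unit_interval" for x
    by measurable
  have "Lp_representation p rep"
  proof
    fix x y :: 'a and c :: complex
    show "1 < p" by (rule p)
    show "rep x \<in> Lp_coins p"
      using integrable_cong_AE[OF powr_digit_meas _ powr_f[of x]] f_int[of x]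
      by (simp add: Lp_coins_def integral_coins_eq(1)[OF powr_meas])
    show "norm x powr p = powr_integral p (rep x)"
    proof -
      have "powr_integral p (rep x) = (\<integral>t. cmod (f x t) powr p \<partial>unit_interval)"
        unfolding powr_integral_def integral_coins_eq(2)[OF powr_meas]
        by (rule integral_cong_AE[OF powr_digit_meas _ powr_f]) measurable
      moreover have "norm x powr p = (\<integral>t. cmod (f x t) powr p \<partial>unit_interval)"
        unfolding J_norm[OF fJ] Lp_norm_def using p by (simp add: powr_powr)
      ultimately show ?thesis by simp
    qed
    have "AE t in unit_interval. f (x + y) t = f x t + f y t"
      using J_add[OF fJ fJ, of x y] by (simp add: Jf)
    with rep_f[of "x + y"] rep_f[of x] rep_f[of y]
    have "AE t in unit_interval. rep (x + y) (digit t) = rep x (digit t) + rep y (digit t)"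
      by eventually_elim simp
    then show "AE \<omega> in coins. rep (x + y) \<omega> = rep x \<omega> + rep y \<omega>" by (rule AE_coins_eqI[rotated 2]) measurable
    have "AE t in unit_interval. f (c *\<^sub>C x) t = c * f x t"
      using J_scale[OF fJ, of c x] by (simp add: Jf)
    with rep_f[of "c *\<^sub>C x"] rep_f[of x]
    have "AE t in unit_interval. rep (c *\<^sub>C x) (digit t) = c * rep x (digit t)"
      by eventually_elim simp
    then show "AE \<omega> in coins. rep (c *\<^sub>C x) \<omega> = c * rep x \<omega>" by (rule AE_coins_eqI[rotated 2]) measurable
  next
    fix F assume F: "F \<in> Lp_coins p"
    note [measurable] = Lp_coins_measurable[OF F]
    \<comment> \<open>For surjectivity, \<open>F\<close> is pulled back along \<open>digit\<close>
      to a function on the interval, whose class is some \<open>J x\<close>.\<close>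
    have FL: "(\<lambda>t. F (digit t)) \<in> Lp_functions p"
      using Lp_coins_integrable[OF F] by (simp add: Lp_functions_def integral_coins_eq(1))
    let ?R = "{(f, g). f \<in> Lp_functions p \<and> g \<in> Lp_functions p \<and> (AE t in unit_interval. f t = g t)}"
    have "?R `` {\<lambda>t. F (digit t)} \<in> Lp_space p"
      unfolding Lp_space_def by (rule quotientI[OF FL])
    then have "?R `` {\<lambda>t. F (digit t)} \<in> range J" by (simp only: bij_betw_imp_surj_on[OF J])
    then obtain x where x: "?R `` {\<lambda>t. F (digit t)} = J x" by (rule rangeE)
    have "(\<lambda>t. F (digit t)) \<in> J x" using FL by (simp flip: x)
    then have "AE t in unit_interval. f x t = F (digit t)" by (simp add: Jf)
    with rep_f[of x] have "AE t in unit_interval. rep x (digit t) = F (digit t)" by eventually_elim simp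
    then have "AE \<omega> in coins. rep x \<omega> = F \<omega>" by (rule AE_coins_eqI[rotated 2]) measurable
    then show "\<exists>x. AE \<omega> in coins. rep x \<omega> = F \<omega>" by blast
  qed
  then show ?thesis by (rule that)
qed

theorem theorem1p1:
  fixes \<phi> :: "('a::complex_banach \<Rightarrow>\<^sub>C\<^sub>L 'a) \<Rightarrow> ('b::complex_banach \<Rightarrow>\<^sub>C\<^sub>L 'b)"
  assumes X_nonzero: "\<exists>x::'a. x \<noteq> 0"
    and Y_nonzero: "\<exists>y::'b. y \<noteq> 0"
    and Y_separable: "separable_space (euclidean :: 'b topology)"
    and Y_reflexive: "reflexive_space TYPE('b)"
    and X_cases:
      "(\<exists>p::real. 1 < p \<and> is_Lp_space p TYPE('a)) \<or>
       (reflexive_space TYPE('a) \<and> (\<exists>b :: nat \<Rightarrow> 'a. subsymmetric_basis b))"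
    and hom: "algebra_hom \<phi>"
    and cont: "continuous_on UNIV \<phi>"
    and inj: "inj \<phi>"
    and dense: "\<exists>T\<in>range \<phi>. closure (range (cblinfun_apply T)) = UNIV"
    and rank_one: "\<And>P. rank_one_idempotent P \<Longrightarrow> rank_one_idempotent (\<phi> P)"
  shows "banach_algebra_iso \<phi>"
proof -
  obtain U V :: "(nat \<Rightarrow> bool) \<Rightarrow> ('a \<Rightarrow>\<^sub>C\<^sub>L 'a)"
    where "norming_dual TYPE('a)" "almost_orthogonal_copies U V"
    using X_cases
  proof (elim disjE exE conjE)
    fix p assume "1 < p" "is_Lp_space p TYPE('a)"
    then obtain rep :: "'a \<Rightarrow> (nat \<Rightarrow> bool) \<Rightarrow> complex" where "Lp_representation p rep"
      by (rule Lp_representation_exists)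
    then interpret Lp_representation p rep .
    show ?thesis by (rule Lp_almost_orthogonal_copies) (rule that[OF norming])
  next
    fix b :: "nat \<Rightarrow> 'a" assume "reflexive_space TYPE('a)" and b: "subsymmetric_basis b"
    then have "norming_dual TYPE('a)" by (rule norming_dual_if_reflexive_basis)
    then show ?thesis by (rule subsymmetric_almost_orthogonal_copies[OF b that])
  qed
  then show ?thesis
    by (rule banach_algebra_iso_if_copies[OF X_nonzero Y_separable _ _ hom cont dense rank_one])
qed

end
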